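(* Let $\mathcal X,\mathcal Y$ be finite sets and $P_{XY}\in\mathcal P(\mathcal X\times\mathcal Y)$ with marginal $P_X$ on $\mathcal X$. Consider the sequence of hypothesis testing problems with null hypothesis $(X^n,Y^n)\sim P_{XY}^{\times n}$ and alternative hypothesis "$X^n\sim P_X^{\times n}$ independent of $Y^n$", i.e. $\mathcal Q_n=\{P_X^{\times n}\times Q_{Y^n}:Q_{Y^n}\in\mathcal P(\mathcal Y^n)\}$. For $s>0$ let $$I_s(X\!:\!Y)=\min_{Q_Y\in\mathcal P(\mathcal Y)}D_s(P_{XY}\|P_X\times Q_Y),$$ let $\phi(s)=(s-1)I_s(X\!:\!Y)$, and let $R_0=\lim_{s\searrow0}(s\phi'(s)-\phi(s))$, $R_\infty=\lim_{s\to\infty}(s\phi'(s)-\phi(s))$. Then the threshold rate and the strong converse threshold rate are both equal to the mutual information $I(X\!:\!Y)=D(P_{XY}\|P_X\times P_Y)$. Moreover, for every $R>R_0$ the error exponent is $$\mathrm e_R=\sup_{s\in(0,1)}\frac{1-s}{s}\big(I_s(X\!:\!Y)-R\big),$$ and for every $0<R<R_\infty$ the strong converse exponent is $$\mathrm{sc}_R=\sup_{s>1}\frac{s-1}{s}\big(R-I_s(X\!:\!Y)\big).$$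
   Context: $\mathcal P(\cdot)$ is the set of probability mass functions on a finite set; $P^{\times n}$ is the $n$-fold i.i.d. product. $\log$ and $\exp$ are inverse to each other, in any fixed base; $-\log0=+\infty$. For a finite set $\mathcal A$, $P\in\mathcal P(\mathcal A)$, $\mathcal Q_n\subseteq\mathcal P(\mathcal A^n)$ (here $\mathcal A=\mathcal X\times\mathcal Y$, $P=P_{XY}$) and a test $T:\mathcal A^n\to[0,1]$ put $\alpha(T)=\sum_{a^n}P^{\times n}(a^n)(1-T(a^n))$, $\beta(T)=\sup_{Q\in\mathcal Q_n}\sum_{a^n}Q(a^n)T(a^n)$, and $\hat\alpha_n(\mu)=\min_T\{\alpha(T):\beta(T)\le\mu\}$. Threshold rate: $\sup\{R\in\mathbb R:\limsup_n\hat\alpha_n(\exp(-nR))=0\}$; strong converse threshold rate: $\inf\{R\in\mathbb R:\liminf_n\hat\alpha_n(\exp(-nR))=1\}$; error exponent: $\mathrm e_R=\liminf_n-\frac1n\log\hat\alpha_n(\exp(-nR))$; strong converse exponent: $\mathrm{sc}_R=\limsup_n-\frac1n\log(1-\hat\alpha_n(\exp(-nR)))$ (both for $R>0$). Rényi divergence: for $s\in(0,1)\cup(1,\infty)$, $D_s(P\|Q)=\frac1{s-1}\log\sum_{a:P(a)>0}P(a)^sQ(a)^{1-s}$ (equal to $+\infty$ if $s>1$ and $Q(a)=0<P(a)$ for some $a$, or if $s<1$ and the sum is $0$); $D_1(P\|Q)=D(P\|Q)=\sum_aP(a)(\log P(a)-\log Q(a))$. *)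

theory Defs
  imports "HOL-Probability.Probability"
begin

section \<open>Composite hypothesis testing\<close>

text \<open>
  \<open>A\<^sup>n\<close> is rendered as the set of lists of length \<open>n\<close> over a finite type, so that
  \<open>P\<^sup>\<times>\<^sup>n\<close> is \<^term>\<open>replicate_pmf n P\<close>. The alternative hypotheses are given as a sequence
  of sets of probability mass functions on lists.
\<close>

definition words :: "nat \<Rightarrow> 'a list set" where
  "words n = {as. length as = n}"

definition tests :: "nat \<Rightarrow> ('a list \<Rightarrow> real) set" where
  "tests n = words n \<rightarrow>\<^sub>E {0..1}"

definition type1_error :: "nat \<Rightarrow> 'a pmf \<Rightarrow> ('a list \<Rightarrow> real) \<Rightarrow> real" where
  "type1_error n P T = (\<Sum>as\<in>words n. pmf (replicate_pmf n P) as * (1 - T as))"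

definition type2_error :: "nat \<Rightarrow> 'a list pmf set \<Rightarrow> ('a list \<Rightarrow> real) \<Rightarrow> real" where
  "type2_error n Qs T = (SUP Q\<in>Qs. \<Sum>as\<in>words n. pmf Q as * T as)"

text \<open>The infimum is a minimum, see \<open>opt_type1_attained\<close> below.\<close>

definition opt_type1 :: "nat \<Rightarrow> 'a pmf \<Rightarrow> 'a list pmf set \<Rightarrow> real \<Rightarrow> real" where
  "opt_type1 n P Qs \<mu> =
     (INF T\<in>{T \<in> tests n. type2_error n Qs T \<le> \<mu>}. type1_error n P T)"

text \<open>The base \<open>b > 1\<close> of the logarithm is a parameter; \<open>exp\<close> is \<open>\<lambda>t. b powr t\<close>.\<close>

definition opt_type1_at_rate ::
  "real \<Rightarrow> 'a pmf \<Rightarrow> (nat \<Rightarrow> 'a list pmf set) \<Rightarrow> real \<Rightarrow> nat \<Rightarrow> real" where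
  "opt_type1_at_rate b P Qs R n = opt_type1 n P (Qs n) (b powr (- real n * R))"

definition neg_log :: "real \<Rightarrow> real \<Rightarrow> ereal" where
  "neg_log b x = (if x = 0 then \<infinity> else ereal (- log b x))"

definition threshold_rate :: "real \<Rightarrow> 'a pmf \<Rightarrow> (nat \<Rightarrow> 'a list pmf set) \<Rightarrow> ereal" where
  "threshold_rate b P Qs =
     Sup (ereal ` {R. limsup (\<lambda>n. ereal (opt_type1_at_rate b P Qs R n)) = 0})"

definition sc_threshold_rate :: "real \<Rightarrow> 'a pmf \<Rightarrow> (nat \<Rightarrow> 'a list pmf set) \<Rightarrow> ereal" where
  "sc_threshold_rate b P Qs =
     Inf (ereal ` {R. liminf (\<lambda>n. ereal (opt_type1_at_rate b P Qs R n)) = 1})"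

definition error_exponent ::
  "real \<Rightarrow> 'a pmf \<Rightarrow> (nat \<Rightarrow> 'a list pmf set) \<Rightarrow> real \<Rightarrow> ereal" where
  "error_exponent b P Qs R =
     liminf (\<lambda>n. ereal (1 / real n) * neg_log b (opt_type1_at_rate b P Qs R n))"

definition sc_exponent ::
  "real \<Rightarrow> 'a pmf \<Rightarrow> (nat \<Rightarrow> 'a list pmf set) \<Rightarrow> real \<Rightarrow> ereal" where
  "sc_exponent b P Qs R =
     limsup (\<lambda>n. ereal (1 / real n) * neg_log b (1 - opt_type1_at_rate b P Qs R n))"


section \<open>Renyi divergence and Renyi mutual information\<close>

text \<open>
  Meant for \<open>s > 0\<close>. If \<open>s < 1\<close>, a term with \<open>Q a = 0\<close> vanishes because \<open>0 powr t = 0\<close>;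
  if \<open>s > 1\<close>, the sum is positive, so the test for \<open>0\<close> only matters for \<open>s < 1\<close>.
\<close>

definition renyi_div :: "real \<Rightarrow> real \<Rightarrow> 'a::finite pmf \<Rightarrow> 'a pmf \<Rightarrow> ereal" where
  "renyi_div b s P Q =
     (if s \<ge> 1 \<and> \<not> set_pmf P \<subseteq> set_pmf Q then \<infinity>
      else if s = 1 then
        ereal (\<Sum>a\<in>set_pmf P. pmf P a * (log b (pmf P a) - log b (pmf Q a)))
      else let S = (\<Sum>a\<in>set_pmf P. pmf P a powr s * pmf Q a powr (1 - s)) in
        if S = 0 then \<infinity> else ereal (1 / (s - 1) * log b S))"

abbreviation marg_X :: "('x \<times> 'y) pmf \<Rightarrow> 'x pmf" where
  "marg_X P \<equiv> map_pmf fst P"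

abbreviation marg_Y :: "('x \<times> 'y) pmf \<Rightarrow> 'y pmf" where
  "marg_Y P \<equiv> map_pmf snd P"

definition mutual_info :: "real \<Rightarrow> ('x::finite \<times> 'y::finite) pmf \<Rightarrow> ereal" where
  "mutual_info b P = renyi_div b 1 P (pair_pmf (marg_X P) (marg_Y P))"

definition renyi_mutual_info :: "real \<Rightarrow> real \<Rightarrow> ('x::finite \<times> 'y::finite) pmf \<Rightarrow> ereal" where
  "renyi_mutual_info b s P = (INF Q. renyi_div b s P (pair_pmf (marg_X P) Q))"

definition phi :: "real \<Rightarrow> ('x::finite \<times> 'y::finite) pmf \<Rightarrow> real \<Rightarrow> real" where
  "phi b P s = (s - 1) * real_of_ereal (renyi_mutual_info b s P)"

definition R_zero :: "real \<Rightarrow> ('x::finite \<times> 'y::finite) pmf \<Rightarrow> ereal" where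
  "R_zero b P = Lim (at_right 0) (\<lambda>s. ereal (s * deriv (phi b P) s - phi b P s))"

definition R_infty :: "real \<Rightarrow> ('x::finite \<times> 'y::finite) pmf \<Rightarrow> ereal" where
  "R_infty b P = Lim at_top (\<lambda>s. ereal (s * deriv (phi b P) s - phi b P s))"

text \<open>
  \<open>P\<^sub>X\<^sup>\<times>\<^sup>n \<times> Q\<close> with \<open>Q\<close> an arbitrary distribution on \<open>Y\<^sup>n\<close>, where a pair of words of length
  \<open>n\<close> is identified with a word of pairs.
\<close>

definition indep_alternatives :: "('x \<times> 'y) pmf \<Rightarrow> nat \<Rightarrow> ('x \<times> 'y) list pmf set" where
  "indep_alternatives P n =
     {map_pmf (\<lambda>(xs, ys). zip xs ys) (pair_pmf (replicate_pmf n (marg_X P)) Q) | Q.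
        set_pmf Q \<subseteq> words n}"


section \<open>The optimal test exists\<close>

lemma finite_words [simp, intro]: "finite (words n :: 'a::finite list set)"
  using finite_lists_length_eq[of "UNIV :: 'a set" n] by (simp add: words_def)

lemma compact_tests: "compact (tests n :: ('a list \<Rightarrow> real) set)"
proof -
  let ?I = "\<lambda>as::'a list. if as \<in> words n then {0..1::real} else {undefined}"
  have "tests n = PiE UNIV ?I"
    by (auto simp: tests_def PiE_iff extensional_def split: if_splits)
  moreover have "compactin (product_topology (\<lambda>_. euclidean) UNIV) (PiE UNIV ?I)"
    by (subst compactin_PiE) auto
  ultimately show ?thesis
    by (simp add: euclidean_product_topology)
qed

lemma type2_error_le_iff:
  fixes Qs :: "'a::finite list pmf set"
  assumes "Qs \<noteq> {}" "T \<in> tests n"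
  shows "type2_error n Qs T \<le> \<mu> \<longleftrightarrow> (\<forall>Q\<in>Qs. (\<Sum>as\<in>words n. pmf Q as * T as) \<le> \<mu>)"
proof -
  have "(\<Sum>as\<in>words n. pmf Q as * T as) \<le> 1" for Q
  proof -
    have "(\<Sum>as\<in>words n. pmf Q as * T as) \<le> (\<Sum>as\<in>words n. pmf Q as)"
      using assms(2) by (intro sum_mono mult_left_le) (auto simp: tests_def PiE_iff)
    also have "\<dots> = measure_pmf.prob Q (words n)"
      by (simp add: measure_measure_pmf_finite)
    finally show ?thesis using measure_pmf.prob_le_1[of Q] by (rule order_trans)
  qed
  then have "bdd_above ((\<lambda>Q. \<Sum>as\<in>words n. pmf Q as * T as) ` Qs)"
    by (intro bdd_aboveI[of _ 1]) auto
  with assms(1) show ?thesis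
    unfolding type2_error_def by (rule cSUP_le_iff)
qed

lemma opt_type1_attained:
  fixes P :: "'a::finite pmf"
  assumes "Qs \<noteq> {}" "\<mu> \<ge> 0"
  shows "\<exists>T\<in>tests n. type2_error n Qs T \<le> \<mu> \<and> type1_error n P T = opt_type1 n P Qs \<mu> \<and>
           (\<forall>T'\<in>tests n. type2_error n Qs T' \<le> \<mu> \<longrightarrow> type1_error n P T \<le> type1_error n P T')"
proof -
  let ?C = "{T. \<forall>Q\<in>Qs. (\<Sum>as\<in>words n. pmf Q as * T as) \<le> \<mu>}"
  let ?F = "{T \<in> tests n. type2_error n Qs T \<le> \<mu>}"
  have F: "?F = tests n \<inter> ?C"
    using type2_error_le_iff[OF assms(1)] by blast
  have "?C = (\<Inter>Q\<in>Qs. {T. (\<Sum>as\<in>words n. pmf Q as * T as) \<le> \<mu>})" by auto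
  also have "closed \<dots>"
    by (intro closed_INT ballI closed_Collect_le continuous_intros
        continuous_on_product_coordinates)
  finally have "compact ?F"
    unfolding F by (intro compact_Int_closed compact_tests)
  moreover have "(\<lambda>as\<in>words n. 0) \<in> ?F"
    using assms(2) unfolding F by (auto simp: tests_def)
  moreover have "continuous_on ?F (type1_error n P)"
    unfolding type1_error_def
    by (intro continuous_intros continuous_on_subset[OF continuous_on_product_coordinates]) auto
  ultimately obtain T where T: "T \<in> ?F" "\<forall>T'\<in>?F. type1_error n P T \<le> type1_error n P T'"
    using continuous_attains_inf[of ?F "type1_error n P"] by blast
  then have "opt_type1 n P Qs \<mu> = type1_error n P T"
    unfolding opt_type1_def by (intro cInf_eq_minimum) auto
  with T show ?thesis by auto
qed

end

theory Submission
  imports Defs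
begin

text \<open>
  Since \<open>Q\<close> is arbitrary on \<open>Y\<^sup>n\<close>, a test is admissible iff for every single \<open>y\<^sup>n\<close> its
  \<open>P\<^sub>X\<^sup>\<times>\<^sup>n\<close>-probability of acceptance is at most the threshold; no universal distribution on types
  is needed. Put \<open>u = 1/s\<close> and \<open>Z(u) = \<Sum>\<^sub>y (\<Sum>\<^sub>x P\<^sub>X(x) P(y|x)\<^sup>s)\<^sup>u\<close>. For \<open>u > 1\<close>, accepting when
  \<open>P(y\<^sup>n|x\<^sup>n)\<close> exceeds a level depending on \<open>y\<^sup>n\<close> has error at most \<open>Z(u)\<^sup>n exp(- n R (1 - u))\<close>; for
  \<open>u < 1\<close>, Hoelder's inequality bounds the success probability of every test by the same expression.
  By Sibson's identity \<open>ln Z(u) = \<phi>(s) / s\<close>, so \<open>s \<phi>'(s) - \<phi>(s) = - (ln Z)'(u)\<close>, which is monotone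
  as \<open>ln Z\<close> is convex. The matching bounds come from a change of measure to the i.i.d. tilted
  distribution whose information density with respect to \<open>P\<^sub>X\<close> has mean \<open>- (ln Z)'(u)\<close>, together with
  the weak law of large numbers; the condition \<open>R > R\<^sub>0\<close> (\<open>R < R\<^sub>\<infinity>\<close>) supplies a suitable \<open>u\<close>.
\<close>

section \<open>Finite sums\<close>

text \<open>Hoelder's inequality with exponents \<open>1 / t\<close> and \<open>1 / (1 - t)\<close>:
  normalise both totals to 1 and sum Young's inequality over \<open>I\<close>. If a total vanishes
  or \<open>I\<close> is infinite, the left side is 0.\<close>

lemma holder_powr_sum:
  fixes a b :: "'i \<Rightarrow> real"
  assumes t: "0 < t" "t < 1" and nonneg: "\<And>i. i \<in> I \<Longrightarrow> a i \<ge> 0" "\<And>i. i \<in> I \<Longrightarrow> b i \<ge> 0"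
  shows "(\<Sum>i\<in>I. a i powr t * b i powr (1 - t)) \<le> (\<Sum>i\<in>I. a i) powr t * (\<Sum>i\<in>I. b i) powr (1 - t)"
proof (cases "finite I \<and> (\<Sum>i\<in>I. a i) \<noteq> 0 \<and> (\<Sum>i\<in>I. b i) \<noteq> 0")
  case True
  define A B where "A = (\<Sum>i\<in>I. a i)" and "B = (\<Sum>i\<in>I. b i)"
  have pos: "A > 0" "B > 0"
    using True nonneg unfolding A_def B_def by (simp_all add: less_le sum_nonneg)
  have "(\<Sum>i\<in>I. (a i / A) powr t * (b i / B) powr (1 - t)) \<le> (\<Sum>i\<in>I. t * (a i / A) + (1 - t) * (b i / B))"
  proof (rule sum_mono)
    fix i assume i: "i \<in> I"
    show "(a i / A) powr t * (b i / B) powr (1 - t) \<le> t * (a i / A) + (1 - t) * (b i / B)"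
    proof (cases "a i = 0 \<or> b i = 0")
      case True
      then show ?thesis using i t nonneg pos by auto
    next
      case False
      then show ?thesis
        using i t nonneg[OF i] pos by (intro Youngs_inequality_0) auto
    qed
  qed
  also have "\<dots> = t * (A / A) + (1 - t) * (B / B)"
    unfolding A_def B_def by (simp only: sum.distrib sum_distrib_left sum_divide_distrib)
  also have "\<dots> = 1" using pos by simp
  finally have "(\<Sum>i\<in>I. (a i / A) powr t * (b i / B) powr (1 - t)) \<le> 1" .
  moreover have "(\<Sum>i\<in>I. (a i / A) powr t * (b i / B) powr (1 - t)) =
      (\<Sum>i\<in>I. a i powr t * b i powr (1 - t)) / (A powr t * B powr (1 - t))"
    unfolding sum_divide_distrib using nonneg pos by (intro sum.cong) (auto simp: powr_divide)
  ultimately show ?thesis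
    using pos unfolding A_def [symmetric] B_def [symmetric] by simp
next
  case False
  then consider "infinite I" | "finite I" "(\<Sum>i\<in>I. a i) = 0" | "finite I" "(\<Sum>i\<in>I. b i) = 0" by blast
  then have "(\<Sum>i\<in>I. a i powr t * b i powr (1 - t)) = 0"
  proof cases
    case 2
    then have "\<forall>i\<in>I. a i = 0" using nonneg by (simp add: sum_nonneg_eq_0_iff)
    then show ?thesis by simp
  next
    case 3
    then have "\<forall>i\<in>I. b i = 0" using nonneg by (simp add: sum_nonneg_eq_0_iff)
    then show ?thesis by simp
  qed simp
  then show ?thesis by simp
qed

lemma sum_UNIV_prod:
  fixes f :: "'a::finite \<times> 'b::finite \<Rightarrow> real"
  shows "(\<Sum>a\<in>UNIV. f a) = (\<Sum>y\<in>UNIV. \<Sum>x\<in>UNIV. f (x, y))"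
proof -
  have "(\<Sum>a\<in>UNIV. f a) = (\<Sum>x\<in>UNIV. \<Sum>y\<in>UNIV. f (x, y))"
    by (simp add: sum.cartesian_product)
  then show ?thesis by (subst sum.swap)
qed

section \<open>Sums over words of fixed length\<close>

lemma words_0 [simp]: "words 0 = {[]}"
  by (auto simp: words_def)

lemma sum_words_Suc:
  fixes F :: "'a::finite list \<Rightarrow> real"
  shows "(\<Sum>as\<in>words (Suc n). F as) = (\<Sum>a\<in>UNIV. \<Sum>as\<in>words n. F (a # as))"
proof -
  have "words (Suc n) = (\<lambda>(a, as). a # as) ` (UNIV \<times> (words n :: 'a list set))"
    by (auto simp: words_def length_Suc_conv image_iff)
  moreover have "inj_on (\<lambda>(a, as). a # as) (UNIV \<times> (words n :: 'a list set))"
    by (auto simp: inj_on_def)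
  ultimately show ?thesis
    by (simp add: sum.reindex sum.cartesian_product case_prod_unfold)
qed

text \<open>Zipping is a bijection from pairs of words onto words of pairs. The sum over
  \<open>ys\<close> is outermost because the testing problem splits along \<open>ys\<close>.\<close>

lemma sum_words_zip:
  fixes F :: "('a::finite \<times> 'b::finite) list \<Rightarrow> real"
  shows "(\<Sum>as\<in>words n. F as) = (\<Sum>ys\<in>words n. \<Sum>xs\<in>words n. F (zip xs ys))"
proof -
  have inj: "inj_on (\<lambda>(ys, xs). zip xs ys) (words n \<times> words n)"
    by (auto simp: inj_on_def words_def zip_eq_conv)
  have "(words n :: ('a \<times> 'b) list set) = (\<lambda>(ys, xs). zip xs ys) ` (words n \<times> words n)"
  proof (intro equalityI subsetI)
    fix as :: "('a \<times> 'b) list" assume "as \<in> words n"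
    then show "as \<in> (\<lambda>(ys, xs). zip xs ys) ` (words n \<times> words n)"
      by (intro image_eqI[of _ _ "(map snd as, map fst as)"]) (auto simp: words_def zip_map_fst_snd)
  qed (auto simp: words_def)
  then show ?thesis
    by (simp add: sum.reindex[OF inj[unfolded case_prod_unfold]] sum.cartesian_product case_prod_unfold)
qed

lemma sum_words_prod_list:
  fixes f :: "'a::finite \<Rightarrow> real"
  shows "(\<Sum>as\<in>words n. prod_list (map f as)) = (\<Sum>a\<in>UNIV. f a) ^ n"
  by (induction n) (simp_all add: sum_words_Suc sum_distrib_left[symmetric] sum_distrib_right[symmetric])

text \<open>For fixed \<open>ys\<close> the letters of \<open>xs\<close> range independently, so the
  sum factorises. This reduces conditional sums over words to single letters.\<close>

lemma sum_words_prod_list_zip: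
  fixes f :: "'a::finite \<times> 'b \<Rightarrow> real"
  assumes "ys \<in> words n"
  shows "(\<Sum>xs\<in>words n. prod_list (map f (zip xs ys))) = prod_list (map (\<lambda>y. \<Sum>x\<in>UNIV. f (x, y)) ys)"
  using assms
proof (induction n arbitrary: ys)
  case (Suc n)
  then obtain y ys' where ys: "ys = y # ys'" "ys' \<in> words n"
    by (auto simp: words_def length_Suc_conv)
  show ?case
    by (simp add: ys sum_words_Suc Suc.IH sum_distrib_left[symmetric] sum_distrib_right[symmetric])
qed (simp add: words_def)

lemma prod_list_map_mult:
  fixes f g :: "'a \<Rightarrow> real"
  shows "prod_list (map (\<lambda>a. f a * g a) as) = prod_list (map f as) * prod_list (map g as)"
  by (induction as) simp_all

lemma prod_list_map_nonneg:
  fixes f :: "'a \<Rightarrow> real"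
  assumes "\<And>a. f a \<ge> 0"
  shows "prod_list (map f as) \<ge> 0"
  using assms by (induction as) simp_all

lemma prod_list_map_powr:
  fixes f :: "'a \<Rightarrow> real"
  assumes "\<And>a. f a \<ge> 0"
  shows "prod_list (map (\<lambda>a. f a powr s) as) = prod_list (map f as) powr s"
  using assms by (induction as) (simp_all add: powr_mult prod_list_map_nonneg)

lemma prod_list_map_eq_exp:
  fixes f :: "'a \<Rightarrow> real"
  assumes "\<And>a. a \<in> set as \<Longrightarrow> f a > 0"
  shows "prod_list (map f as) = exp (\<Sum>a\<leftarrow>as. ln (f a))"
  using assms by (induction as) (simp_all add: exp_add)

lemma prod_list_zip_fst_mult:
  fixes f :: "'a \<Rightarrow> real" and g :: "'a \<times> 'b \<Rightarrow> real"
  assumes "length xs = length ys"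
  shows "prod_list (map (\<lambda>a. f (fst a) * g a) (zip xs ys)) = prod_list (map f xs) * prod_list (map g (zip xs ys))"
  using assms by (induction xs ys rule: list_induct2) simp_all

section \<open>Weak law of large numbers\<close>

lemma sum_words_variance:
  fixes v l :: "'a::finite \<Rightarrow> real"
  assumes "(\<Sum>a\<in>UNIV. v a) = 1" and "(\<Sum>a\<in>UNIV. v a * l a) = 0"
  shows "(\<Sum>as\<in>words n. prod_list (map v as) * (\<Sum>a\<leftarrow>as. l a)\<^sup>2) = n * (\<Sum>a\<in>UNIV. v a * (l a)\<^sup>2)"
proof (induction n)
  case (Suc n)
  have *: "(\<Sum>as\<in>words n. prod_list (map v as) * (l a + (\<Sum>a\<leftarrow>as. l a))\<^sup>2) =
      (l a)\<^sup>2 + 2 * l a * (\<Sum>as\<in>words n. prod_list (map v as) * (\<Sum>a\<leftarrow>as. l a))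
       + n * (\<Sum>a\<in>UNIV. v a * (l a)\<^sup>2)" for a
  proof -
    have "(\<Sum>as\<in>words n. prod_list (map v as) * (l a + (\<Sum>a\<leftarrow>as. l a))\<^sup>2) =
      (\<Sum>as\<in>words n. (l a)\<^sup>2 * prod_list (map v as) + 2 * l a * (prod_list (map v as) * (\<Sum>a\<leftarrow>as. l a))
         + prod_list (map v as) * (\<Sum>a\<leftarrow>as. l a)\<^sup>2)"
      by (intro sum.cong) (auto simp: power2_eq_square algebra_simps)
    also have "\<dots> = (l a)\<^sup>2 * (\<Sum>as\<in>words n. prod_list (map v as))
        + 2 * l a * (\<Sum>as\<in>words n. prod_list (map v as) * (\<Sum>a\<leftarrow>as. l a))
         + (\<Sum>as\<in>words n. prod_list (map v as) * (\<Sum>a\<leftarrow>as. l a)\<^sup>2)"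
      by (simp only: sum.distrib sum_distrib_left)
    finally show ?thesis by (simp add: Suc.IH sum_words_prod_list assms)
  qed
  \<comment> \<open>The mean \<open>M\<close> of the remaining letters needs no evaluation: its
    coefficient is twice the mean of \<open>l\<close>, which is 0, so the cross term drops out and
    the variances add up.\<close>
  define M where "M = (\<Sum>as\<in>words n. prod_list (map v as) * (\<Sum>a\<leftarrow>as. l a))"
  define C where "C = n * (\<Sum>a\<in>UNIV. v a * (l a)\<^sup>2)"
  have "(\<Sum>as\<in>words (Suc n). prod_list (map v as) * (\<Sum>a\<leftarrow>as. l a)\<^sup>2) =
      (\<Sum>a\<in>UNIV. v a * (\<Sum>as\<in>words n. prod_list (map v as) * (l a + (\<Sum>a\<leftarrow>as. l a))\<^sup>2))"
    by (simp add: sum_words_Suc sum_distrib_left mult.assoc)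
  also have "\<dots> = (\<Sum>a\<in>UNIV. v a * (l a)\<^sup>2 + v a * l a * (2 * M) + v a * C)"
    unfolding * M_def [symmetric] C_def [symmetric] by (simp add: algebra_simps)
  also have "\<dots> = (\<Sum>a\<in>UNIV. v a * (l a)\<^sup>2) + (\<Sum>a\<in>UNIV. v a * l a) * (2 * M) + (\<Sum>a\<in>UNIV. v a) * C"
    by (simp only: sum.distrib sum_distrib_right)
  finally show ?case using assms unfolding C_def by (simp only:) (simp add: algebra_simps)
qed simp

text \<open>Chebyshev's inequality: the sum of the letters has variance \<open>n * \<sigma>\<close>,
  so the words deviating by more than \<open>n * \<delta>\<close> have mass at most
  \<open>\<sigma> / \<delta>\<^sup>2 / n\<close>.\<close>

lemma weak_law_words:
  fixes v l :: "'a::finite \<Rightarrow> real" and r \<delta> \<eta> :: real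
  assumes v: "\<And>a. v a \<ge> 0" "(\<Sum>a\<in>UNIV. v a) = 1" and r: "(\<Sum>a\<in>UNIV. v a * l a) = r"
    and \<delta>: "\<delta> > 0" and \<eta>: "\<eta> < 1"
  shows "\<forall>\<^sub>F n in sequentially.
    \<eta> \<le> (\<Sum>as | as \<in> words n \<and> \<bar>(\<Sum>a\<leftarrow>as. l a) - n * r\<bar> \<le> n * \<delta>. prod_list (map v as))"
proof -
  define \<sigma> where "\<sigma> = (\<Sum>a\<in>UNIV. v a * (l a - r)\<^sup>2)"
  have nn: "prod_list (map v as) \<ge> 0" for as
    by (intro prod_list_map_nonneg v)
  have bound: "(\<Sum>as | as \<in> words n \<and> \<bar>(\<Sum>a\<leftarrow>as. l a) - n * r\<bar> \<le> n * \<delta>. prod_list (map v as))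
      \<ge> 1 - \<sigma> / \<delta>\<^sup>2 / n" if n: "n > 0" for n
  proof -
    let ?G = "{as. as \<in> words n \<and> \<bar>(\<Sum>a\<leftarrow>as. l a) - n * r\<bar> \<le> n * \<delta>}"
    have shift: "(\<Sum>a\<leftarrow>as. l a - r) = (\<Sum>a\<leftarrow>as. l a) - n * r" if "as \<in> words n" for as
      using that by (simp add: words_def sum_list_subtractf sum_list_triv)
    have mean0: "(\<Sum>a\<in>UNIV. v a * (l a - r)) = 0"
      using v r by (simp add: right_diff_distrib sum_subtractf sum_distrib_right[symmetric])
    have "(n * \<delta>)\<^sup>2 * (\<Sum>as\<in>words n - ?G. prod_list (map v as)) \<le>
        (\<Sum>as\<in>words n - ?G. prod_list (map v as) * (\<Sum>a\<leftarrow>as. l a - r)\<^sup>2)"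
      unfolding sum_distrib_left
    proof (rule sum_mono)
      fix as assume as: "as \<in> words n - ?G"
      then have "(n * \<delta>)\<^sup>2 \<le> (\<Sum>a\<leftarrow>as. l a - r)\<^sup>2"
        using \<delta> by (subst abs_le_square_iff[symmetric]) (auto simp: shift)
      then show "(n * \<delta>)\<^sup>2 * prod_list (map v as) \<le> prod_list (map v as) * (\<Sum>a\<leftarrow>as. l a - r)\<^sup>2"
        by (subst (2) mult.commute) (rule mult_right_mono[OF _ nn])
    qed
    also have "\<dots> \<le> (\<Sum>as\<in>words n. prod_list (map v as) * (\<Sum>a\<leftarrow>as. l a - r)\<^sup>2)"
      by (intro sum_mono2) (auto intro!: mult_nonneg_nonneg nn)
    also have "\<dots> = n * \<sigma>"
      unfolding \<sigma>_def by (rule sum_words_variance[OF v(2) mean0])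
    finally have "(\<Sum>as\<in>words n - ?G. prod_list (map v as)) \<le> \<sigma> / \<delta>\<^sup>2 / n"
      using n \<delta> by (simp add: field_simps power2_eq_square)
    moreover have "(\<Sum>as\<in>words n. prod_list (map v as)) =
        (\<Sum>as\<in>words n - ?G. prod_list (map v as)) + (\<Sum>as\<in>?G. prod_list (map v as))"
      by (intro sum.subset_diff) auto
    ultimately show ?thesis using v by (simp add: sum_words_prod_list)
  qed
  have "((\<lambda>n. 1 - \<sigma> / \<delta>\<^sup>2 / real n) \<longlongrightarrow> 1 - 0) sequentially"
    by (intro tendsto_intros tendsto_divide_0[OF tendsto_const] filterlim_real_sequentially
        filterlim_at_top_imp_at_infinity)
  then have "\<forall>\<^sub>F n in sequentially. \<eta> < 1 - \<sigma> / \<delta>\<^sup>2 / real n"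
    using \<eta> by (intro order_tendstoD(1)) auto
  then show ?thesis
    using eventually_gt_at_top[of 0]
  proof eventually_elim
    case (elim n)
    then show ?case using bound[of n] by linarith
  qed
qed

lemma pmf_replicate:
  fixes P :: "'a::finite pmf"
  assumes "as \<in> words n"
  shows "pmf (replicate_pmf n P) as = prod_list (map (pmf P) as)"
  using assms
proof (induction n arbitrary: as)
  case (Suc n)
  then obtain a as' where as: "as = a # as'" "as' \<in> words n"
    by (auto simp: words_def length_Suc_conv)
  have "replicate_pmf (Suc n) P = map_pmf (\<lambda>(a, as). a # as) (pair_pmf P (replicate_pmf n P))"
    by (simp add: map_pmf_def pair_pmf_def bind_assoc_pmf bind_return_pmf)
  then have "pmf (replicate_pmf (Suc n) P) as =
      pmf (map_pmf (\<lambda>(a, as). a # as) (pair_pmf P (replicate_pmf n P))) ((\<lambda>(a, as). a # as) (a, as'))"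
    by (simp add: as)
  also have "\<dots> = pmf (pair_pmf P (replicate_pmf n P)) (a, as')"
    by (intro pmf_map_inj') (auto simp: inj_def)
  finally show ?case by (simp add: pmf_pair as Suc.IH)
qed (simp add: words_def)


section \<open>One-shot bounds\<close>

text \<open>Accept \<open>x\<close> when \<open>w x y\<close> exceeds a level \<open>c y\<close>.
  Markov's inequality for \<open>w x y powr s\<close> bounds the false acceptance, and the error on
  the rejected part is bounded through \<open>w x y \<le> c y\<close>. In the application
  \<open>p\<close> is the law of the \<open>X\<close>-word, \<open>w\<close> the conditional
  probability of the \<open>Y\<close>-word, and each \<open>y\<close> a point mass as
  alternative.\<close>

lemma one_shot_direct:
  fixes p :: "'i \<Rightarrow> real" and w :: "'i \<Rightarrow> 'j \<Rightarrow> real"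
  assumes p: "\<And>x. p x \<ge> 0" and w: "\<And>x y. w x y \<ge> 0" and s: "0 < s" "s < 1" and \<mu>: "\<mu> > 0"
  shows "\<exists>t. (\<forall>x y. 0 \<le> t x y \<and> t x y \<le> 1) \<and> (\<forall>y. (\<Sum>x\<in>I. p x * t x y) \<le> \<mu>) \<and>
    (\<Sum>y\<in>J. \<Sum>x\<in>I. p x * w x y * (1 - t x y)) \<le>
      (\<Sum>y\<in>J. (\<Sum>x\<in>I. p x * w x y powr s) powr (1 / s)) * \<mu> powr (1 - 1 / s)"
proof -
  define g where "g y = (\<Sum>x\<in>I. p x * w x y powr s)" for y
  \<comment> \<open>the level at which Markov's inequality for \<open>w\<^sup>s\<close> gives the bound \<open>\<mu>\<close>\<close>
  define c where "c y = (g y / \<mu>) powr (1 / s)" for y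
  define t :: "'i \<Rightarrow> 'j \<Rightarrow> real" where "t x y = of_bool (c y < w x y)" for x y
  have g: "g y \<ge> 0" for y
    unfolding g_def by (intro sum_nonneg mult_nonneg_nonneg p) auto
  have term_nonneg: "p x * w x y powr s \<ge> 0" for x y
    using p by simp
  have feasible: "(\<Sum>x\<in>I. p x * t x y) \<le> \<mu>" for y
  proof (cases "finite I \<and> g y \<noteq> 0")
    case True
    have "g y * (p x * t x y) \<le> \<mu> * (p x * w x y powr s)" for x
    proof (cases "c y < w x y")
      case True
      then have "c y powr s \<le> w x y powr s"
        using s unfolding c_def by (intro powr_mono2) auto
      then have "g y \<le> \<mu> * w x y powr s"
        using s \<mu> g[of y] by (simp add: c_def powr_powr field_simps)
      with True show ?thesis
        using mult_left_mono[OF _ p[of x]] by (fastforce simp: t_def algebra_simps)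
    next
      case False
      then show ?thesis using term_nonneg[of x y] \<mu> by (simp add: t_def)
    qed
    then have "g y * (\<Sum>x\<in>I. p x * t x y) \<le> \<mu> * g y"
      unfolding g_def [of y, THEN arg_cong[where f = "(*) \<mu>"]] sum_distrib_left by (rule sum_mono)
    then show ?thesis using True g[of y] by (simp add: mult.commute)
  next
    case False
    \<comment> \<open>If \<open>g y = 0\<close> with \<open>I\<close> finite, then
      \<open>c y = 0\<close> and each product \<open>p x * w x y powr s\<close> vanishes: an
      accepted \<open>x\<close> has \<open>w x y > 0\<close>, hence \<open>p x = 0\<close>.\<close>
    have "p x * t x y = 0" if "finite I" "x \<in> I" for x
    proof -
      have "p x * w x y powr s = 0"
        using False that term_nonneg unfolding g_def by (simp add: sum_nonneg_eq_0_iff)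
      then show ?thesis using False that s w[of x y] by (auto simp: t_def c_def)
    qed
    then have "(\<Sum>x\<in>I. p x * t x y) = 0" by (cases "finite I") (auto intro!: sum.neutral simp del: mult_eq_0_iff)
    then show ?thesis using \<mu> by simp
  qed
  have "(\<Sum>x\<in>I. p x * w x y * (1 - t x y)) \<le> g y powr (1 / s) * \<mu> powr (1 - 1 / s)" for y
  proof -
    \<comment> \<open>On the rejected part write \<open>w\<close> as
      \<open>w powr s * w powr (1 - s)\<close> and estimate the second factor by the level; its
      exponent \<open>1 - s\<close> is positive.\<close>
    have "p x * w x y * (1 - t x y) \<le> p x * w x y powr s * c y powr (1 - s)" for x
    proof (cases "c y < w x y \<or> w x y = 0")
      case True
      then show ?thesis using p w s by (auto simp: t_def)
    next
      case False
      then have "w x y > 0" "w x y \<le> c y" using w[of x y] by auto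
      then have "w x y powr (1 - s) \<le> c y powr (1 - s)"
        using s by (intro powr_mono2) auto
      then have "w x y powr s * w x y powr (1 - s) \<le> w x y powr s * c y powr (1 - s)"
        by (intro mult_left_mono) auto
      also have "w x y powr s * w x y powr (1 - s) = w x y"
        using \<open>w x y > 0\<close> by (simp add: powr_add[symmetric])
      finally have "p x * w x y \<le> p x * (w x y powr s * c y powr (1 - s))"
        by (intro mult_left_mono p)
      with False show ?thesis by (simp add: t_def mult.assoc)
    qed
    then have "(\<Sum>x\<in>I. p x * w x y * (1 - t x y)) \<le> (\<Sum>x\<in>I. p x * w x y powr s * c y powr (1 - s))"
      by (rule sum_mono)
    also have "\<dots> = g y * c y powr (1 - s)"
      by (simp add: g_def sum_distrib_right)
    also have "\<dots> = g y powr (1 / s) * \<mu> powr (1 - 1 / s)"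
    proof (cases "g y = 0")
      case False
      have "g y * c y powr (1 - s) = g y powr 1 * (g y powr ((1 - s) / s) / \<mu> powr ((1 - s) / s))"
        using False g[of y] \<mu> by (simp add: c_def powr_powr powr_divide)
      also have "\<dots> = g y powr (1 + (1 - s) / s) * \<mu> powr (- ((1 - s) / s))"
        unfolding powr_add by (simp add: powr_minus_divide)
      also have "\<dots> = g y powr (1 / s) * \<mu> powr (1 - 1 / s)"
        using s by (intro arg_cong2[where f = "(*)"] arg_cong2[where f = "(powr)"] refl) (auto simp: field_simps)
      finally show ?thesis .
    qed simp
    finally show ?thesis .
  qed
  then have "(\<Sum>y\<in>J. \<Sum>x\<in>I. p x * w x y * (1 - t x y)) \<le> (\<Sum>y\<in>J. g y powr (1 / s) * \<mu> powr (1 - 1 / s))"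
    by (rule sum_mono)
  then show ?thesis
    using feasible unfolding g_def sum_distrib_right [symmetric] by (intro exI[of _ t]) (auto simp: t_def)
qed

text \<open>For each \<open>y\<close>, enlarge \<open>t\<close> to
  \<open>t powr (1 - 1 / s)\<close>, which is possible since \<open>t\<close> lies between 0 and 1,
  and apply Hoelder's inequality. One factor is then a power of the false acceptance probability,
  hence of at most \<open>\<mu>\<close>.\<close>

lemma one_shot_strong_converse:
  fixes p :: "'i \<Rightarrow> real" and w t :: "'i \<Rightarrow> 'j \<Rightarrow> real"
  assumes p: "\<And>x. p x \<ge> 0" and w: "\<And>x y. w x y \<ge> 0" and s: "1 < s"
    and t: "\<And>x y. x \<in> I \<Longrightarrow> y \<in> J \<Longrightarrow> 0 \<le> t x y \<and> t x y \<le> 1"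
    and feasible: "\<And>y. y \<in> J \<Longrightarrow> (\<Sum>x\<in>I. p x * t x y) \<le> \<mu>"
  shows "(\<Sum>y\<in>J. \<Sum>x\<in>I. p x * w x y * t x y) \<le>
      (\<Sum>y\<in>J. (\<Sum>x\<in>I. p x * w x y powr s) powr (1 / s)) * \<mu> powr (1 - 1 / s)"
  unfolding sum_distrib_right
proof (rule sum_mono)
  fix y assume y: "y \<in> J"
  have "p x * w x y * t x y \<le> (p x * w x y powr s) powr (1 / s) * (p x * t x y) powr (1 - 1 / s)"
    if x: "x \<in> I" for x
  proof -
    have le: "t x y \<le> t x y powr (1 - 1 / s)"
    proof (cases "t x y = 0")
      case False
      then have "t x y powr 1 \<le> t x y powr (1 - 1 / s)"
        using t[OF x y] s by (intro powr_mono') auto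
      then show ?thesis using t[OF x y] by simp
    qed simp
    have "p x powr (1 / s) * p x powr (1 - 1 / s) = p x"
      using p[of x] by (cases "p x = 0") (auto simp: powr_add[symmetric])
    then have "(p x * w x y powr s) powr (1 / s) * (p x * t x y) powr (1 - 1 / s)
        = p x * w x y * t x y powr (1 - 1 / s)"
      using p w s t[OF x y] by (simp add: powr_mult powr_powr algebra_simps)
    with le show ?thesis by (simp add: mult_left_mono p w)
  qed
  then have "(\<Sum>x\<in>I. p x * w x y * t x y) \<le>
      (\<Sum>x\<in>I. (p x * w x y powr s) powr (1 / s) * (p x * t x y) powr (1 - 1 / s))"
    by (rule sum_mono)
  also have "\<dots> \<le> (\<Sum>x\<in>I. p x * w x y powr s) powr (1 / s) * (\<Sum>x\<in>I. p x * t x y) powr (1 - 1 / s)"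
    using s p t y by (intro holder_powr_sum) auto
  also have "\<dots> \<le> (\<Sum>x\<in>I. p x * w x y powr s) powr (1 / s) * \<mu> powr (1 - 1 / s)"
    using s p t y feasible[OF y] by (intro mult_left_mono powr_mono2 sum_nonneg) auto
  finally show "(\<Sum>x\<in>I. p x * w x y * t x y) \<le>
    (\<Sum>x\<in>I. p x * w x y powr s) powr (1 / s) * \<mu> powr (1 - 1 / s)" .
qed


section \<open>The optimal error against independent alternatives\<close>

text \<open>Testing against all point masses on \<open>Y\<^sup>n\<close> suffices, so the problem splits into one
  Neyman-Pearson problem for each \<open>ys\<close>.\<close>

definition feasible_test :: "('x::finite \<times> 'y::finite) pmf \<Rightarrow> nat \<Rightarrow> real \<Rightarrow> (('x \<times> 'y) list \<Rightarrow> real) \<Rightarrow> bool" where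
  "feasible_test P n \<mu> T \<longleftrightarrow> (\<forall>as\<in>words n. 0 \<le> T as \<and> T as \<le> 1) \<and>
     (\<forall>ys\<in>words n. (\<Sum>xs\<in>words n. prod_list (map (pmf (marg_X P)) xs) * T (zip xs ys)) \<le> \<mu>)"

lemma indep_alternatives_nonempty: "indep_alternatives P n \<noteq> {}"
  unfolding indep_alternatives_def
  by (auto intro!: exI[of _ "return_pmf (replicate n undefined)"] simp: words_def)

text \<open>The acceptance probability under an alternative is the \<open>Q\<close>-average of the
  values \<open>err ys\<close>. A bound for all \<open>Q\<close> is therefore a bound for each
  \<open>ys\<close>, as point masses show.\<close>

lemma type2_error_indep_alternatives_le_iff:
  fixes P :: "('x::finite \<times> 'y::finite) pmf"
  assumes T: "T \<in> tests n"
  shows "type2_error n (indep_alternatives P n) T \<le> \<mu> \<longleftrightarrow> feasible_test P n \<mu> T"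
proof -
  let ?PX = "replicate_pmf n (marg_X P)"
  let ?alt = "\<lambda>Q. map_pmf (\<lambda>(xs, ys). zip xs ys) (pair_pmf ?PX Q)"
  have inj_zip: "inj_on (\<lambda>(xs, ys). zip xs ys) (words n \<times> words n :: ('x list \<times> 'y list) set)"
  proof (rule inj_onI, clarify)
    fix xs xs' :: "'x list" and ys ys' :: "'y list"
    assume eq: "zip xs ys = zip xs' ys'" and len: "xs \<in> words n" "ys \<in> words n" "xs' \<in> words n" "ys' \<in> words n"
    show "xs = xs' \<and> ys = ys'"
      using len arg_cong[OF eq, of "map fst"] arg_cong[OF eq, of "map snd"] by (simp add: words_def)
  qed
  have supp: "set_pmf (pair_pmf ?PX Q) \<subseteq> words n \<times> words n" if "set_pmf Q \<subseteq> words n" for Q :: "'y list pmf"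
    using that by (force simp: set_replicate_pmf words_def)
  \<comment> \<open>\<open>zip\<close> is injective only on pairs of words of equal length, so
    injectivity is used on the support; points outside the support are shown to have mass 0 on both
    sides.\<close>
  have pmf_alt: "pmf (?alt Q) (zip xs ys) = prod_list (map (pmf (marg_X P)) xs) * pmf Q ys"
    if "set_pmf Q \<subseteq> words n" "xs \<in> words n" "ys \<in> words n" for Q :: "'y list pmf" and xs ys
  proof (cases "(xs, ys) \<in> set_pmf (pair_pmf ?PX Q)")
    case True
    have "inj_on (\<lambda>(xs, ys). zip xs ys) (set_pmf (pair_pmf ?PX Q))"
      using inj_on_subset[OF inj_zip supp[OF that(1)]] .
    from pmf_map_inj[OF this True] show ?thesis
      using that by (simp add: pmf_pair pmf_replicate)
  next
    case False
    have "zip xs ys \<notin> set_pmf (?alt Q)"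
    proof
      assume "zip xs ys \<in> set_pmf (?alt Q)"
      then obtain z where z: "z \<in> set_pmf (pair_pmf ?PX Q)" "(\<lambda>(xs, ys). zip xs ys) z = zip xs ys"
        by (auto simp del: set_pair_pmf)
      then have "z = (xs, ys)"
        using supp[OF that(1)] that(2,3) by (intro inj_onD[OF inj_zip]) auto
      with z False show False by simp
    qed
    moreover have "pmf (pair_pmf ?PX Q) (xs, ys) = 0" using False by (simp add: set_pmf_eq)
    ultimately show ?thesis
      using that by (simp add: pmf_pair pmf_replicate set_pmf_eq)
  qed
  define err where "err ys = (\<Sum>xs\<in>words n. prod_list (map (pmf (marg_X P)) xs) * T (zip xs ys))" for ys
  have error_alt: "(\<Sum>as\<in>words n. pmf (?alt Q) as * T as) = (\<Sum>ys\<in>words n. pmf Q ys * err ys)"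
    if "set_pmf Q \<subseteq> words n" for Q
    unfolding sum_words_zip err_def sum_distrib_left
    by (intro sum.cong) (auto simp: pmf_alt[OF that])
  have "(\<forall>Q\<in>indep_alternatives P n. (\<Sum>as\<in>words n. pmf Q as * T as) \<le> \<mu>) \<longleftrightarrow>
      (\<forall>ys\<in>words n. err ys \<le> \<mu>)"
  proof (intro iffI ballI)
    fix ys :: "'y list" assume L: "\<forall>Q\<in>indep_alternatives P n. (\<Sum>as\<in>words n. pmf Q as * T as) \<le> \<mu>"
      and ys: "ys \<in> words n"
    have "(\<Sum>zs\<in>words n. pmf (return_pmf ys) zs * err zs) = (\<Sum>zs\<in>words n. if zs = ys then err zs else 0)"
      by (intro sum.cong) auto
    also have "\<dots> = err ys" using ys by simp
    finally have "(\<Sum>as\<in>words n. pmf (?alt (return_pmf ys)) as * T as) = err ys"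
      using ys error_alt[of "return_pmf ys"] by simp
    moreover have "?alt (return_pmf ys) \<in> indep_alternatives P n"
      unfolding indep_alternatives_def using ys by (auto intro!: exI[of _ "return_pmf ys"])
    ultimately show "err ys \<le> \<mu>" using L by metis
  next
    fix Q' assume R: "\<forall>ys\<in>words n. err ys \<le> \<mu>" and "Q' \<in> indep_alternatives P n"
    then obtain Q :: "'y list pmf" where Q: "Q' = ?alt Q" "set_pmf Q \<subseteq> words n"
      by (auto simp: indep_alternatives_def)
    have "(\<Sum>ys\<in>words n. pmf Q ys * err ys) \<le> (\<Sum>ys\<in>words n. pmf Q ys * \<mu>)"
      using R by (intro sum_mono mult_left_mono) auto
    also have "\<dots> = \<mu>"
      using Q(2) by (simp add: sum_distrib_right[symmetric] sum_pmf_eq_1)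
    finally show "(\<Sum>as\<in>words n. pmf Q' as * T as) \<le> \<mu>"
      using error_alt[OF Q(2)] Q(1) by simp
  qed
  with T show ?thesis
    unfolding type2_error_le_iff[OF indep_alternatives_nonempty T] feasible_test_def err_def
    by (auto simp: tests_def PiE_iff)
qed

lemma opt_type1_indep_alternatives_le:
  fixes P :: "('x::finite \<times> 'y::finite) pmf"
  assumes "feasible_test P n \<mu> T" "\<mu> \<ge> 0"
  shows "opt_type1 n P (indep_alternatives P n) \<mu> \<le> (\<Sum>as\<in>words n. prod_list (map (pmf P) as) * (1 - T as))"
proof -
  \<comment> \<open>\<open>tests n\<close> contains extensional functions only; restricting changes
    neither feasibility nor the error.\<close>
  let ?T = "restrict T (words n)"
  have "feasible_test P n \<mu> ?T \<longleftrightarrow> feasible_test P n \<mu> T"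
    unfolding feasible_test_def by (intro conj_cong ball_cong arg_cong2[where f = "(\<le>)"] sum.cong refl)
      (auto simp: words_def)
  with assms have fs: "feasible_test P n \<mu> ?T" by simp
  then have T: "?T \<in> tests n" by (auto simp: tests_def feasible_test_def)
  from opt_type1_attained[OF indep_alternatives_nonempty assms(2), of n P n P]
  have "opt_type1 n P (indep_alternatives P n) \<mu> \<le> type1_error n P ?T"
    using fs T type2_error_indep_alternatives_le_iff[OF T, of P \<mu>] by auto
  also have "\<dots> = (\<Sum>as\<in>words n. prod_list (map (pmf P) as) * (1 - T as))"
    unfolding type1_error_def by (intro sum.cong) (auto simp: pmf_replicate)
  finally show ?thesis .
qed

lemma opt_type1_indep_alternatives_attained:
  fixes P :: "('x::finite \<times> 'y::finite) pmf"
  assumes "\<mu> \<ge> 0"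
  obtains T where "feasible_test P n \<mu> T"
    "opt_type1 n P (indep_alternatives P n) \<mu> = (\<Sum>as\<in>words n. prod_list (map (pmf P) as) * (1 - T as))"
proof -
  from opt_type1_attained[OF indep_alternatives_nonempty assms, of n P n P] obtain T where T: "T \<in> tests n"
    "type2_error n (indep_alternatives P n) T \<le> \<mu>" "type1_error n P T = opt_type1 n P (indep_alternatives P n) \<mu>"
    by blast
  show ?thesis
    by (rule that[of T]) (use T in \<open>auto simp: type2_error_indep_alternatives_le_iff type1_error_def
        pmf_replicate intro!: sum.cong\<close>)
qed


section \<open>Finite block length bounds\<close>

context
  fixes P :: "('x::finite \<times> 'y::finite) pmf"
begin

text \<open>The conditional probability of \<open>y\<close> given \<open>x\<close>; division by zero
  makes it 0 where the \<open>X\<close>-marginal vanishes.\<close>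

definition chan :: "'x \<times> 'y \<Rightarrow> real" where
  "chan a = pmf P a / pmf (marg_X P) (fst a)"

text \<open>Its power \<open>1 / s\<close>, normalised over \<open>y\<close>, is the minimising
  distribution in Sibson's identity.\<close>

definition gsum :: "real \<Rightarrow> 'y \<Rightarrow> real" where
  "gsum s y = (\<Sum>x\<in>UNIV. pmf (marg_X P) x * chan (x, y) powr s)"

text \<open>Everything is parametrised by \<open>u = 1 / s\<close>: \<open>ln (gallager u)\<close> is \<open>\<phi>(s) / s\<close> in nats, and it is
  convex in \<open>u\<close>.\<close>

definition gallager :: "real \<Rightarrow> real" where
  "gallager u = (\<Sum>y\<in>UNIV. gsum (1 / u) y powr u)"

text \<open>\<open>tilted u\<close> is a distribution on \<open>X \<times> Y\<close>, and \<open>tilted_ratio u (x, y)\<close> is the ratio of its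
  conditional distribution of \<open>x\<close> given \<open>y\<close> to \<open>P\<^sub>X\<close>.\<close>

definition tilted_ratio :: "real \<Rightarrow> 'x \<times> 'y \<Rightarrow> real" where
  "tilted_ratio u a = chan a powr (1 / u) / gsum (1 / u) (snd a)"

definition tilted :: "real \<Rightarrow> 'x \<times> 'y \<Rightarrow> real" where
  "tilted u a = pmf (marg_X P) (fst a) * (gsum (1 / u) (snd a) powr u / gallager u) * tilted_ratio u a"

text \<open>In nats, the divergence of \<open>tilted u\<close> from the product of the
  \<open>X\<close>-marginal of \<open>P\<close> with the \<open>Y\<close>-marginal of
  \<open>tilted u\<close>. It turns out to be minus the derivative of
  \<open>ln (gallager u)\<close>.\<close>

definition tilted_rate :: "real \<Rightarrow> real" where
  "tilted_rate u = (\<Sum>a\<in>UNIV. tilted u a * ln (tilted_ratio u a))"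

lemma chan_nonneg [simp]: "chan a \<ge> 0"
  by (simp add: chan_def)

lemma pmf_le_marg_X: "pmf P a \<le> pmf (marg_X P) (fst a)"
  unfolding pmf_map pmf.rep_eq[of P]
  by (intro measure_pmf.finite_measure_mono) auto

lemma pmf_eq_chan: "pmf P a = pmf (marg_X P) (fst a) * chan a"
  using pmf_le_marg_X[of a] by (cases "pmf (marg_X P) (fst a) = 0") (auto simp: chan_def)

lemma sum_pmf_X: "(\<Sum>x\<in>UNIV. pmf P (x, y)) = pmf (marg_Y P) y"
proof -
  have "pmf (marg_Y P) y = measure P ((\<lambda>x. (x, y)) ` UNIV)"
    unfolding pmf_map by (intro arg_cong[where f = "measure P"]) auto
  also have "\<dots> = (\<Sum>a\<in>(\<lambda>x. (x, y)) ` UNIV. pmf P a)"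
    by (rule measure_measure_pmf_finite) simp
  also have "\<dots> = (\<Sum>x\<in>UNIV. pmf P (x, y))"
    by (subst sum.reindex) (auto simp: inj_on_def)
  finally show ?thesis by simp
qed

lemma gsum_nonneg [simp]: "gsum s y \<ge> 0"
  unfolding gsum_def by (intro sum_nonneg) auto

lemma gsum_pos:
  assumes "pmf P (x, y) \<noteq> 0"
  shows "gsum s y > 0"
proof -
  have "0 < pmf (marg_X P) x * chan (x, y) powr s"
    using assms pmf_eq_chan[of "(x, y)"] by (auto simp: less_le)
  also have "\<dots> \<le> gsum s y"
    unfolding gsum_def by (intro member_le_sum) auto
  finally show ?thesis .
qed

text \<open>The support in \<open>y\<close> is the same for every \<open>s\<close>, which allows
  logarithms and derivatives in \<open>s\<close> to be taken separately for each
  \<open>y\<close>.\<close>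

lemma gsum_pos_iff: "gsum s y > 0 \<longleftrightarrow> y \<in> set_pmf (marg_Y P)"
proof
  assume "gsum s y > 0"
  then obtain x where "pmf (marg_X P) x * chan (x, y) powr s \<noteq> 0"
    unfolding gsum_def by (metis (mono_tags, lifting) less_irrefl sum.neutral)
  then have "(x, y) \<in> set_pmf P" by (auto simp: set_pmf_eq pmf_eq_chan)
  then show "y \<in> set_pmf (marg_Y P)" by force
next
  assume "y \<in> set_pmf (marg_Y P)"
  then obtain x where "(x, y) \<in> set_pmf P" by auto
  then show "gsum s y > 0" by (intro gsum_pos) (simp add: set_pmf_eq)
qed

lemma gallager_pos: "gallager u > 0"
proof -
  obtain y where y: "y \<in> set_pmf (marg_Y P)" using set_pmf_not_empty by fast
  have "0 < gsum (1 / u) y powr u" using y gsum_pos_iff[of "1/u" y] by auto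
  also have "\<dots> \<le> gallager u"
    unfolding gallager_def by (intro member_le_sum) auto
  finally show ?thesis .
qed

lemma gallager_nonzero: "gallager u \<noteq> 0"
  using gallager_pos[of u] by simp

lemma tilted_ratio_nonneg [simp]: "tilted_ratio u a \<ge> 0"
  by (simp add: tilted_ratio_def)

lemma tilted_nonneg [simp]: "tilted u a \<ge> 0"
  unfolding tilted_def using gallager_pos[of u] by simp

text \<open>Where \<open>gsum\<close> vanishes, division by zero gives 0 in place of 1. In both
  cases the value is at most 1, so Markov's inequality applies to the ratio for every
  \<open>y\<close>.\<close>

lemma sum_tilted_ratio:
  "(\<Sum>x\<in>UNIV. pmf (marg_X P) x * tilted_ratio u (x, y)) = of_bool (gsum (1 / u) y \<noteq> 0)"
  by (simp add: tilted_ratio_def gsum_def[symmetric] sum_divide_distrib[symmetric])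

lemma sum_tilted: "(\<Sum>a\<in>UNIV. tilted u a) = 1"
proof -
  have "(\<Sum>a\<in>UNIV. tilted u a) =
      (\<Sum>y\<in>UNIV. gsum (1 / u) y powr u / gallager u * (\<Sum>x\<in>UNIV. pmf (marg_X P) x * tilted_ratio u (x, y)))"
    unfolding sum_UNIV_prod by (simp add: tilted_def sum_distrib_left mult_ac)
  also have "\<dots> = (\<Sum>y\<in>UNIV. gsum (1 / u) y powr u / gallager u)"
    by (intro sum.cong) (auto simp: sum_tilted_ratio)
  also have "\<dots> = 1"
    using gallager_pos[of u] by (simp add: sum_divide_distrib[symmetric] gallager_def[symmetric])
  finally show ?thesis .
qed

text \<open>Change of measure: the density of \<open>P\<close> with respect to
  \<open>tilted u\<close> is a power of \<open>tilted_ratio u\<close>, up to a constant. Hence one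
  typical event, on which the logarithm of the ratio is close to its mean, controls both kinds of
  error.\<close>

lemma pmf_eq_tilted:
  assumes "u > 0"
  shows "pmf P a = tilted u a * gallager u * tilted_ratio u a powr (u - 1)"
proof (cases "pmf P a = 0")
  case True
  then have "pmf (marg_X P) (fst a) = 0 \<or> chan a = 0" by (simp add: pmf_eq_chan)
  with True show ?thesis by (auto simp: tilted_def tilted_ratio_def)
next
  case False
  then have g: "gsum (1 / u) (snd a) > 0" using gsum_pos[of "fst a" "snd a"] by simp
  have c: "chan a > 0" using False by (auto simp: pmf_eq_chan less_le)
  then have r: "tilted_ratio u a > 0" using g by (simp add: tilted_ratio_def)
  have "tilted u a * gallager u * tilted_ratio u a powr (u - 1) =
      pmf (marg_X P) (fst a) * (gsum (1 / u) (snd a) powr u * (tilted_ratio u a powr 1 * tilted_ratio u a powr (u - 1)))"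
    using gallager_pos[of u] r by (simp add: tilted_def)
  \<comment> \<open>The ratio is the \<open>1 / u\<close>-th power of \<open>chan a\<close> over
    \<open>gsum\<close>; raising it to \<open>u\<close> recovers \<open>chan a\<close>.\<close>
  also have "tilted_ratio u a powr 1 * tilted_ratio u a powr (u - 1) = tilted_ratio u a powr u"
    by (subst powr_add[symmetric]) simp
  also have "gsum (1 / u) (snd a) powr u * tilted_ratio u a powr u = chan a"
    using g c assms by (simp add: tilted_ratio_def powr_divide powr_powr)
  finally show ?thesis by (simp add: pmf_eq_chan)
qed

lemma tilted_ratio_pos: "tilted u a \<noteq> 0 \<Longrightarrow> tilted_ratio u a > 0"
  by (auto simp: tilted_def less_le)

section \<open>Multiplicativity over letters and the one-shot bounds for words\<close>

abbreviation chan_words :: "'x list \<Rightarrow> 'y list \<Rightarrow> real" where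
  "chan_words xs ys \<equiv> prod_list (map chan (zip xs ys))"

abbreviation pX_words :: "'x list \<Rightarrow> real" where
  "pX_words xs \<equiv> prod_list (map (pmf (marg_X P)) xs)"

lemma prod_list_pmf_zip:
  assumes "xs \<in> words n" "ys \<in> words n"
  shows "prod_list (map (pmf P) (zip xs ys)) = pX_words xs * chan_words xs ys"
  using assms unfolding pmf_eq_chan[abs_def] by (subst prod_list_zip_fst_mult) (auto simp: words_def)

lemma sum_words_chan:
  assumes "ys \<in> words n"
  shows "(\<Sum>xs\<in>words n. pX_words xs * chan_words xs ys powr s) = prod_list (map (gsum s) ys)"
proof -
  have "(\<Sum>xs\<in>words n. pX_words xs * chan_words xs ys powr s) =
      (\<Sum>xs\<in>words n. prod_list (map (\<lambda>a. pmf (marg_X P) (fst a) * chan a powr s) (zip xs ys)))"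
    using assms by (intro sum.cong refl, subst prod_list_zip_fst_mult) (auto simp: words_def prod_list_map_powr)
  also have "\<dots> = prod_list (map (gsum s) ys)"
    unfolding sum_words_prod_list_zip[OF assms] by (simp add: gsum_def[abs_def])
  finally show ?thesis .
qed

text \<open>The inner sum factorises for each fixed \<open>ys\<close>, then the outer one does; this
  turns the one-shot bounds into bounds with an \<open>n\<close>-th power.\<close>

lemma sum_words_gsum:
  "(\<Sum>ys\<in>words n. (\<Sum>xs\<in>words n. pX_words xs * chan_words xs ys powr s) powr (1 / s)) = gallager (1 / s) ^ n"
proof -
  have "(\<Sum>ys\<in>words n. (\<Sum>xs\<in>words n. pX_words xs * chan_words xs ys powr s) powr (1 / s)) =
      (\<Sum>ys\<in>words n. prod_list (map (\<lambda>y. gsum s y powr (1 / s)) ys))"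
    by (intro sum.cong refl) (simp add: sum_words_chan prod_list_map_powr)
  then show ?thesis by (simp add: sum_words_prod_list gallager_def)
qed

lemma sum_words_pmf: "(\<Sum>as\<in>words n. prod_list (map (pmf P) as)) = 1"
  by (simp add: sum_words_prod_list sum_pmf_eq_1)

lemma opt_type1_direct:
  assumes s: "0 < s" "s < 1" and "\<mu> > 0"
  shows "opt_type1 n P (indep_alternatives P n) \<mu> \<le> gallager (1 / s) ^ n * \<mu> powr (1 - 1 / s)"
proof -
  obtain t where t: "\<forall>xs ys. 0 \<le> t xs ys \<and> t xs ys \<le> 1"
    "\<forall>ys. (\<Sum>xs\<in>words n. pX_words xs * t xs ys) \<le> \<mu>"
    "(\<Sum>ys\<in>words n. \<Sum>xs\<in>words n. pX_words xs * chan_words xs ys * (1 - t xs ys)) \<le>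
      (\<Sum>ys\<in>words n. (\<Sum>xs\<in>words n. pX_words xs * chan_words xs ys powr s) powr (1 / s)) * \<mu> powr (1 - 1 / s)"
    using one_shot_direct[of pX_words chan_words s \<mu> "words n" "words n"] assms
    by (auto simp: prod_list_map_nonneg)
  define T where "T as = t (map fst as) (map snd as)" for as
  have T_zip: "T (zip xs ys) = t xs ys" if "xs \<in> words n" "ys \<in> words n" for xs ys
    using that by (simp add: T_def words_def)
  have "feasible_test P n \<mu> T"
    unfolding feasible_test_def using t(1,2) by (simp add: T_zip) (simp add: T_def)
  then have "opt_type1 n P (indep_alternatives P n) \<mu> \<le> (\<Sum>as\<in>words n. prod_list (map (pmf P) as) * (1 - T as))"
    using assms by (intro opt_type1_indep_alternatives_le) auto
  also have "\<dots> = (\<Sum>ys\<in>words n. \<Sum>xs\<in>words n. pX_words xs * chan_words xs ys * (1 - t xs ys))"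
    unfolding sum_words_zip by (intro sum.cong refl) (simp add: T_zip prod_list_pmf_zip)
  also note t(3)
  finally show ?thesis unfolding sum_words_gsum .
qed

lemma opt_type1_strong_converse:
  assumes s: "1 < s" and "\<mu> > 0"
  shows "1 - opt_type1 n P (indep_alternatives P n) \<mu> \<le> gallager (1 / s) ^ n * \<mu> powr (1 - 1 / s)"
proof -
  obtain T where T: "feasible_test P n \<mu> T"
    "opt_type1 n P (indep_alternatives P n) \<mu> = (\<Sum>as\<in>words n. prod_list (map (pmf P) as) * (1 - T as))"
    using opt_type1_indep_alternatives_attained[of \<mu> P n] assms by auto
  have "1 - opt_type1 n P (indep_alternatives P n) \<mu> = (\<Sum>as\<in>words n. prod_list (map (pmf P) as) * T as)"
    unfolding T(2) by (simp add: right_diff_distrib sum_subtractf sum_words_pmf)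
  also have "\<dots> = (\<Sum>ys\<in>words n. \<Sum>xs\<in>words n. pX_words xs * chan_words xs ys * T (zip xs ys))"
    unfolding sum_words_zip by (intro sum.cong refl) (simp add: prod_list_pmf_zip)
  also have "\<dots> \<le> (\<Sum>ys\<in>words n. (\<Sum>xs\<in>words n. pX_words xs * chan_words xs ys powr s) powr (1 / s)) * \<mu> powr (1 - 1 / s)"
  proof (rule one_shot_strong_converse[OF _ _ s])
    show "0 \<le> T (zip xs ys) \<and> T (zip xs ys) \<le> 1" if "xs \<in> words n" "ys \<in> words n" for xs ys
      using T(1) that by (auto simp: feasible_test_def words_def)
    show "(\<Sum>xs\<in>words n. pX_words xs * T (zip xs ys)) \<le> \<mu>" if "ys \<in> words n" for ys
      using T(1) that by (auto simp: feasible_test_def)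
  qed (auto simp: prod_list_map_nonneg)
  finally show ?thesis unfolding sum_words_gsum .
qed

section \<open>Matching bounds by change of measure\<close>

lemma prod_list_pmf_eq_tilted:
  assumes "u > 0" "as \<in> words n"
  shows "prod_list (map (pmf P) as) =
    prod_list (map (tilted u) as) * gallager u ^ n * prod_list (map (tilted_ratio u) as) powr (u - 1)"
  using assms unfolding pmf_eq_tilted[OF assms(1), abs_def] prod_list_map_mult
  by (simp add: prod_list_map_powr words_def map_replicate_const prod_list_replicate)

lemma prod_list_tilted_zip:
  assumes "xs \<in> words n" "ys \<in> words n"
  shows "prod_list (map (tilted u) (zip xs ys)) = pX_words xs *
    (prod_list (map (\<lambda>y. gsum (1 / u) y powr u / gallager u) ys) * prod_list (map (tilted_ratio u) (zip xs ys)))"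
proof -
  have "length xs = length ys" using assms by (simp add: words_def)
  then show ?thesis by (induction xs ys rule: list_induct2) (simp_all add: tilted_def)
qed

text \<open>Nonzero tilted mass forces every ratio to be positive, so \<open>ln\<close> is never
  taken at 0. Words of tilted mass 0 are treated separately below.\<close>

lemma prod_list_tilted_ratio_eq_exp:
  assumes "prod_list (map (tilted u) as) \<noteq> 0"
  shows "prod_list (map (tilted_ratio u) as) = exp (\<Sum>a\<leftarrow>as. ln (tilted_ratio u a))"
proof (rule prod_list_map_eq_exp)
  fix a assume "a \<in> set as"
  then have "tilted u a \<noteq> 0" using assms by (auto simp: prod_list_zero_iff image_iff)
  then show "tilted_ratio u a > 0" by (rule tilted_ratio_pos)
qed

text \<open>On typical words the ratio is at most \<open>exp (n * (r + \<epsilon>))\<close>, so a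
  feasible test accepts them with tilted probability at most
  \<open>exp (- n * (R - r - \<epsilon>))\<close>, which tends to 0. It therefore rejects typical
  words of tilted mass at least \<open>1 / 2\<close>, and the change of measure converts this into
  an error under \<open>P\<close>.\<close>

lemma opt_type1_converse:
  fixes R :: real
  assumes u: "u > 1" and R: "tilted_rate u < R" and \<delta>: "\<delta> > 0"
  shows "\<forall>\<^sub>F n in sequentially. 1 / 2 * (gallager u ^ n * exp (n * (tilted_rate u - \<delta>) * (u - 1)))
    \<le> opt_type1 n P (indep_alternatives P n) (exp (- real n * R))"
proof -
  define r where "r = tilted_rate u"
  \<comment> \<open>\<open>\<epsilon> \<le> \<delta>\<close> serves the return to \<open>P\<close>;
    the halving keeps \<open>r + \<epsilon>\<close> strictly below \<open>R\<close>, so that the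
    accepted mass decays.\<close>
  define \<epsilon> where "\<epsilon> = min \<delta> ((R - r) / 2)"
  have \<epsilon>: "\<epsilon> > 0" "\<epsilon> \<le> \<delta>" "r + \<epsilon> < R" using R \<delta> unfolding \<epsilon>_def r_def by (auto simp: min_def field_simps)
  \<comment> \<open>Typical mass \<open>3 / 4\<close>, less the accepted mass \<open>1 / 4\<close>,
    leaves the factor \<open>1 / 2\<close>.\<close>
  have "\<forall>\<^sub>F n in sequentially. 3 / 4 \<le> (\<Sum>as | as \<in> words n \<and>
      \<bar>(\<Sum>a\<leftarrow>as. ln (tilted_ratio u a)) - n * r\<bar> \<le> n * \<epsilon>. prod_list (map (tilted u) as))"
    using \<epsilon> by (intro weak_law_words sum_tilted) (auto simp: r_def tilted_rate_def)
  moreover have "((\<lambda>n. exp (- (R - (r + \<epsilon>))) ^ n) \<longlongrightarrow> 0) sequentially"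
    using \<epsilon> by (intro LIMSEQ_realpow_zero) auto
  then have "\<forall>\<^sub>F n in sequentially. exp (- (R - (r + \<epsilon>))) ^ n < 1 / 4"
    by (intro order_tendstoD(2)) auto
  ultimately show ?thesis
  proof eventually_elim
    case (elim n)
    define \<mu> where "\<mu> = exp (- real n * R)"
    let ?G = "{as. as \<in> words n \<and> \<bar>(\<Sum>a\<leftarrow>as. ln (tilted_ratio u a)) - n * r\<bar> \<le> n * \<epsilon>}"
    let ?v = "\<lambda>as. prod_list (map (tilted u) as)"
    let ?q = "\<lambda>ys. prod_list (map (\<lambda>y. gsum (1 / u) y powr u / gallager u) ys)"
    have q: "?q ys \<ge> 0" for ys using gallager_pos[of u] by (intro prod_list_map_nonneg) auto
    have v: "?v as \<ge> 0" for as by (intro prod_list_map_nonneg) auto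
    obtain T where T: "feasible_test P n \<mu> T"
      "opt_type1 n P (indep_alternatives P n) \<mu> = (\<Sum>as\<in>words n. prod_list (map (pmf P) as) * (1 - T as))"
      using opt_type1_indep_alternatives_attained[of \<mu> P n] unfolding \<mu>_def by auto
    have T01: "0 \<le> T as" "T as \<le> 1" if "as \<in> words n" for as
      using T(1) that by (auto simp: feasible_test_def)
    have "(\<Sum>as\<in>?G. ?v as * T as) = (\<Sum>as\<in>words n. (if as \<in> ?G then ?v as else 0) * T as)"
      by (intro sum.mono_neutral_cong_left) auto
    \<comment> \<open>Compare with the alternative whose \<open>Y\<close>-part \<open>?q\<close> is
      the \<open>Y\<close>-marginal of the tilted word distribution: the ratio of the two is
      \<open>tilted_ratio\<close>, bounded on \<open>?G\<close>.\<close>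
    also have "\<dots> \<le> (\<Sum>ys\<in>words n. \<Sum>xs\<in>words n. pX_words xs * (?q ys * exp (n * (r + \<epsilon>))) * T (zip xs ys))"
      unfolding sum_words_zip
    proof (intro sum_mono mult_right_mono)
      fix xs :: "'x list" and ys :: "'y list" assume *: "ys \<in> words n" "xs \<in> words n"
      have nn: "0 \<le> pX_words xs * (?q ys * exp (n * (r + \<epsilon>)))"
        using q by (simp add: prod_list_map_nonneg)
      have "?v (zip xs ys) \<le> pX_words xs * (?q ys * exp (n * (r + \<epsilon>)))" if G: "zip xs ys \<in> ?G"
      proof (cases "?v (zip xs ys) = 0")
        case False
        have "prod_list (map (tilted_ratio u) (zip xs ys)) \<le> exp (n * (r + \<epsilon>))"
          unfolding prod_list_tilted_ratio_eq_exp[OF False] using G by (auto simp: algebra_simps)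
        then show ?thesis
          unfolding prod_list_tilted_zip[OF *(2,1)] using q by (intro mult_left_mono) (auto simp: prod_list_map_nonneg)
      qed (use nn in simp)
      with nn show "(if zip xs ys \<in> ?G then ?v (zip xs ys) else 0) \<le> pX_words xs * (?q ys * exp (n * (r + \<epsilon>)))"
        by simp
      show "0 \<le> T (zip xs ys)" using * by (intro T01) (auto simp: words_def)
    qed
    also have "\<dots> = exp (n * (r + \<epsilon>)) * (\<Sum>ys\<in>words n. ?q ys * (\<Sum>xs\<in>words n. pX_words xs * T (zip xs ys)))"
      unfolding sum_distrib_left by (intro sum.cong refl) (simp add: mult_ac)
    also have "\<dots> \<le> exp (n * (r + \<epsilon>)) * (\<Sum>ys\<in>words n. ?q ys * \<mu>)"
      using T(1) q by (intro mult_left_mono sum_mono) (auto simp: feasible_test_def)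
    also have "\<dots> = exp (n * (r + \<epsilon>)) * \<mu>"
      using gallager_pos[of u]
      by (simp add: sum_distrib_right[symmetric] sum_words_prod_list sum_divide_distrib[symmetric] gallager_def[symmetric])
    also have "\<dots> = exp (- (R - (r + \<epsilon>))) ^ n"
      by (simp add: \<mu>_def mult_exp_exp exp_of_nat_mult[symmetric] algebra_simps)
    finally have "(\<Sum>as\<in>?G. ?v as * T as) \<le> 1 / 4" using elim(2) by linarith
    moreover have "(\<Sum>as\<in>?G. ?v as * (1 - T as)) = (\<Sum>as\<in>?G. ?v as) - (\<Sum>as\<in>?G. ?v as * T as)"
      by (simp add: right_diff_distrib sum_subtractf)
    ultimately have half: "1 / 2 \<le> (\<Sum>as\<in>?G. ?v as * (1 - T as))" using elim(1) by linarith
    define K where "K = gallager u ^ n * exp (n * (r - \<delta>) * (u - 1))"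
    have K: "K \<ge> 0" using gallager_pos[of u] by (simp add: K_def)
    from half have "1 / 2 * K \<le> (\<Sum>as\<in>?G. ?v as * (1 - T as)) * K"
      by (rule mult_right_mono[OF _ K])
    also have "\<dots> \<le> (\<Sum>as\<in>?G. prod_list (map (pmf P) as) * (1 - T as))"
      unfolding sum_distrib_right
    proof (rule sum_mono)
      fix as assume as: "as \<in> ?G"
      have "?v as * K \<le> prod_list (map (pmf P) as)"
      proof (cases "?v as = 0")
        case False
        have "n * \<epsilon> \<le> n * \<delta>" using \<epsilon> by (intro mult_left_mono) auto
        then have "n * (r - \<delta>) \<le> n * r - n * \<epsilon>" by (simp add: algebra_simps)
        also have "\<dots> \<le> (\<Sum>a\<leftarrow>as. ln (tilted_ratio u a))" using as by auto
        \<comment> \<open>As \<open>u - 1 > 0\<close>, the lower end of the typical interval bounds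
          the power from below.\<close>
        finally have "exp (n * (r - \<delta>) * (u - 1)) \<le> prod_list (map (tilted_ratio u) as) powr (u - 1)"
          using u unfolding prod_list_tilted_ratio_eq_exp[OF False] by (simp add: powr_def mult_left_mono mult.commute)
        then show ?thesis
          using as u v gallager_pos[of u] by (subst prod_list_pmf_eq_tilted[of u]) (auto simp: K_def mult.assoc intro!: mult_left_mono)
      qed (simp add: prod_list_map_nonneg)
      then show "?v as * (1 - T as) * K \<le> prod_list (map (pmf P) as) * (1 - T as)"
        using T01[of as] as mult_right_mono[of "?v as * K" "prod_list (map (pmf P) as)" "1 - T as"]
        by (simp add: mult_ac)
    qed
    also have "\<dots> \<le> (\<Sum>as\<in>words n. prod_list (map (pmf P) as) * (1 - T as))"
      using T01 by (intro sum_mono2) (auto simp: prod_list_map_nonneg)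
    finally show ?case using T(2) by (simp add: K_def \<mu>_def r_def)
  qed
qed

text \<open>Accept when the ratio is at least \<open>exp (n * R)\<close>. For every
  \<open>ys\<close> the ratio has mean at most 1, so Markov's inequality gives feasibility. Typical
  words of nonzero tilted mass are all accepted because \<open>R \<le> r - \<epsilon>\<close>, and
  the change of measure bounds their probability under \<open>P\<close>.\<close>

lemma opt_type1_achievable:
  fixes R :: real
  assumes u: "0 < u" "u < 1" and R: "R < tilted_rate u" and \<delta>: "\<delta> > 0"
  shows "\<forall>\<^sub>F n in sequentially. 1 / 2 * (gallager u ^ n * exp (n * (tilted_rate u + \<delta>) * (u - 1)))
    \<le> 1 - opt_type1 n P (indep_alternatives P n) (exp (- real n * R))"
proof -
  define r where "r = tilted_rate u"
  define \<epsilon> where "\<epsilon> = min \<delta> (r - R)"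
  have \<epsilon>: "\<epsilon> > 0" "\<epsilon> \<le> \<delta>" "R \<le> r - \<epsilon>" using R \<delta> unfolding \<epsilon>_def r_def by auto
  have "\<forall>\<^sub>F n in sequentially. 1 / 2 \<le> (\<Sum>as | as \<in> words n \<and>
      \<bar>(\<Sum>a\<leftarrow>as. ln (tilted_ratio u a)) - n * r\<bar> \<le> n * \<epsilon>. prod_list (map (tilted u) as))"
    using \<epsilon> by (intro weak_law_words sum_tilted) (auto simp: r_def tilted_rate_def)
  then show ?thesis
  proof eventually_elim
    case (elim n)
    define \<mu> where "\<mu> = exp (- real n * R)"
    let ?G = "{as. as \<in> words n \<and> \<bar>(\<Sum>a\<leftarrow>as. ln (tilted_ratio u a)) - n * r\<bar> \<le> n * \<epsilon>}"
    let ?v = "\<lambda>as. prod_list (map (tilted u) as)"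
    let ?\<rho> = "\<lambda>as. prod_list (map (tilted_ratio u) as)"
    have v: "?v as \<ge> 0" for as by (intro prod_list_map_nonneg) auto
    have \<rho>: "?\<rho> as \<ge> 0" for as by (intro prod_list_map_nonneg) auto
    define T :: "('x \<times> 'y) list \<Rightarrow> real" where "T as = of_bool (exp (n * R) \<le> ?\<rho> as)" for as
    have "feasible_test P n \<mu> T"
      unfolding feasible_test_def
    proof (intro conjI ballI)
      fix ys :: "'y list" assume ys: "ys \<in> words n"
      have "(\<Sum>xs\<in>words n. pX_words xs * T (zip xs ys)) \<le> (\<Sum>xs\<in>words n. pX_words xs * (\<mu> * ?\<rho> (zip xs ys)))"
        using \<rho> by (intro sum_mono mult_left_mono)
          (auto simp: T_def \<mu>_def prod_list_map_nonneg exp_minus field_simps)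
      also have "\<dots> = \<mu> * (\<Sum>xs\<in>words n. prod_list (map (\<lambda>a. pmf (marg_X P) (fst a) * tilted_ratio u a) (zip xs ys)))"
        unfolding sum_distrib_left using ys
        by (intro sum.cong refl, subst prod_list_zip_fst_mult) (auto simp: words_def)
      also have "\<dots> = \<mu> * prod_list (map (\<lambda>y. of_bool (gsum (1 / u) y \<noteq> 0)) ys)"
        unfolding sum_words_prod_list_zip[OF ys] by (simp add: sum_tilted_ratio)
      also have "\<dots> \<le> \<mu> * 1"
        by (intro mult_left_mono, induction ys) (auto simp: \<mu>_def)
      finally show "(\<Sum>xs\<in>words n. pX_words xs * T (zip xs ys)) \<le> \<mu>" by simp
    qed (auto simp: T_def)
    then have "opt_type1 n P (indep_alternatives P n) \<mu> \<le> (\<Sum>as\<in>words n. prod_list (map (pmf P) as) * (1 - T as))"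
      by (intro opt_type1_indep_alternatives_le) (auto simp: \<mu>_def)
    also have "\<dots> = 1 - (\<Sum>as\<in>words n. prod_list (map (pmf P) as) * T as)"
      by (simp add: right_diff_distrib sum_subtractf sum_words_pmf)
    finally have opt: "(\<Sum>as\<in>words n. prod_list (map (pmf P) as) * T as) \<le> 1 - opt_type1 n P (indep_alternatives P n) \<mu>"
      by simp
    define K where "K = gallager u ^ n * exp (n * (r + \<delta>) * (u - 1))"
    have K: "K \<ge> 0" using gallager_pos[of u] by (simp add: K_def)
    from elim have "1 / 2 * K \<le> (\<Sum>as\<in>?G. ?v as) * K"
      by (rule mult_right_mono[OF _ K])
    also have "\<dots> \<le> (\<Sum>as\<in>?G. prod_list (map (pmf P) as) * T as)"
      unfolding sum_distrib_right
    proof (rule sum_mono)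
      fix as assume as: "as \<in> ?G"
      show "?v as * K \<le> prod_list (map (pmf P) as) * T as"
      proof (cases "?v as = 0")
        case False
        let ?L = "\<Sum>a\<leftarrow>as. ln (tilted_ratio u a)"
        have L: "?L \<le> n * r + n * \<epsilon>" "n * r - n * \<epsilon> \<le> ?L" using as by auto
        have "n * R \<le> n * (r - \<epsilon>)" using \<epsilon>(3) by (intro mult_left_mono) auto
        with L have T1: "T as = 1"
          unfolding T_def prod_list_tilted_ratio_eq_exp[OF False] by (simp add: algebra_simps)
        have "n * \<epsilon> \<le> n * \<delta>" using \<epsilon> by (intro mult_left_mono) auto
        with L have "?L \<le> n * (r + \<delta>)" by (simp add: algebra_simps)
        \<comment> \<open>Now \<open>u - 1 < 0\<close>, so the upper end of the typical interval is
          the relevant one.\<close>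
        then have "n * (r + \<delta>) * (u - 1) \<le> ?L * (u - 1)"
          using u by (intro mult_right_mono_neg) auto
        then have "exp (n * (r + \<delta>) * (u - 1)) \<le> ?\<rho> as powr (u - 1)"
          unfolding prod_list_tilted_ratio_eq_exp[OF False] by (simp add: powr_def mult.commute)
        then show ?thesis
          using as u v gallager_pos[of u]
          by (subst prod_list_pmf_eq_tilted[of u]) (auto simp: K_def mult.assoc T1 intro!: mult_left_mono)
      qed (simp add: prod_list_map_nonneg T_def)
    qed
    also have "\<dots> \<le> (\<Sum>as\<in>words n. prod_list (map (pmf P) as) * T as)"
      by (intro sum_mono2) (auto simp: prod_list_map_nonneg T_def)
    also note opt
    finally show ?case by (simp add: K_def \<mu>_def r_def)
  qed
qed

end


section \<open>Analytic properties of the Gallager function\<close>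

text \<open>For \<open>a = 0\<close> the function is constant, since \<open>0 powr s = 0\<close> for
  every \<open>s\<close>.\<close>

lemma has_real_derivative_powr_exponent:
  assumes "a \<ge> 0"
  shows "((\<lambda>s. a powr s) has_real_derivative a powr s * ln a) (at s)"
proof (cases "a = 0")
  case False
  then show ?thesis using assms by (auto intro!: derivative_eq_intros)
qed simp

context
  fixes P :: "('x::finite \<times> 'y::finite) pmf"
begin

lemma has_real_derivative_gsum:
  "((\<lambda>s. gsum P s y) has_real_derivative
     (\<Sum>x\<in>UNIV. pmf (marg_X P) x * (chan P (x, y) powr s * ln (chan P (x, y))))) (at s)"
  unfolding gsum_def
  by (intro DERIV_sum DERIV_cmult has_real_derivative_powr_exponent) simp

text \<open>Differentiate \<open>exp (u * ln (gsum P (1 / u) y))\<close> for each \<open>y\<close>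
  in the support. Since \<open>ln (tilted_ratio P u (x, y))\<close> equals
  \<open>ln (chan P (x, y)) / u - ln (gsum P (1 / u) y)\<close> where \<open>chan\<close> is
  positive, the terms assemble to a mean under \<open>tilted\<close>.\<close>

lemma has_real_derivative_ln_gallager:
  assumes u: "u > 0"
  shows "((\<lambda>u. ln (gallager P u)) has_real_derivative - tilted_rate P u) (at u)"
proof -
  \<comment> \<open>The contribution of \<open>y\<close> to the derivative of
    \<open>gallager\<close>; the factor \<open>gallager P u\<close> cancels in the logarithmic
    derivative.\<close>
  define D where "D y = - (\<Sum>x\<in>UNIV. tilted P u (x, y) * ln (tilted_ratio P u (x, y))) * gallager P u" for y
  have D: "((\<lambda>u. gsum P (1 / u) y powr u) has_real_derivative D y) (at u)" for y
  proof (cases "y \<in> set_pmf (marg_Y P)")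
    case False
    then have g: "gsum P s y = 0" for s
      using gsum_pos_iff[of P s y] gsum_nonneg[of P s y] by linarith
    have "tilted P u (x, y) = 0" for x using u by (simp add: tilted_def g)
    then show ?thesis by (simp add: D_def g)
  next
    case True
    then have g: "gsum P s y > 0" for s using gsum_pos_iff[of P s y] by simp
    define d where "d = (\<Sum>x\<in>UNIV. pmf (marg_X P) x * (chan P (x, y) powr (1 / u) * ln (chan P (x, y))))"
    let ?g = "gsum P (1 / u) y"
    have "((\<lambda>u. gsum P (1 / u) y) has_real_derivative d * (- 1 / u\<^sup>2)) (at u)"
      unfolding d_def using u
      by (intro DERIV_chain2[OF has_real_derivative_gsum])
        (auto intro!: derivative_eq_intros simp: power2_eq_square)
    then have "((\<lambda>u. exp (u * ln (gsum P (1 / u) y))) has_real_derivative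
        exp (u * ln ?g) * (ln ?g + u * (d * (- 1 / u\<^sup>2) / ?g))) (at u)"
      using g by (auto intro!: derivative_eq_intros simp: mult_ac)
    moreover have "(\<lambda>u. exp (u * ln (gsum P (1 / u) y))) = (\<lambda>u. gsum P (1 / u) y powr u)"
      using g by (simp add: powr_def less_imp_neq[OF g, symmetric])
    moreover have "exp (u * ln ?g) * (ln ?g + u * (d * (- 1 / u\<^sup>2) / ?g)) = D y"
    proof -
      have summand: "tilted P u (x, y) * ln (tilted_ratio P u (x, y)) * gallager P u =
          ?g powr u / ?g / u * (pmf (marg_X P) x * (chan P (x, y) powr (1 / u) * ln (chan P (x, y))))
            - ?g powr u / ?g * ln ?g * (pmf (marg_X P) x * chan P (x, y) powr (1 / u))" for x
      proof (cases "chan P (x, y) = 0")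
        case False
        then have c: "chan P (x, y) > 0" using chan_nonneg[of P "(x, y)"] by linarith
        have l: "ln (tilted_ratio P u (x, y)) = ln (chan P (x, y)) / u - ln ?g"
          using c g[of "1/u"] by (simp add: tilted_ratio_def ln_div ln_powr)
        show ?thesis
          using gallager_pos[of P u] g[of "1/u"] u unfolding l
          by (simp add: tilted_def tilted_ratio_def field_simps)
      qed (simp add: tilted_def tilted_ratio_def)
      have "D y = - (?g powr u / ?g / u * d - ?g powr u / ?g * ln ?g * ?g)"
        unfolding D_def d_def minus_mult_left [symmetric] sum_distrib_right summand
        by (simp only: sum_subtractf sum_distrib_left[symmetric] gsum_def[symmetric])
      also have "\<dots> = exp (u * ln ?g) * (ln ?g + u * (d * (- 1 / u\<^sup>2) / ?g))"
        using g[of "1/u"] u by (simp add: powr_def less_imp_neq[OF g, symmetric] field_simps power2_eq_square)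
      finally show ?thesis by simp
    qed
    ultimately show ?thesis by simp
  qed
  have "(gallager P has_real_derivative (\<Sum>y\<in>UNIV. D y)) (at u)"
    unfolding gallager_def[abs_def] by (intro DERIV_sum D)
  then have "((\<lambda>u. ln (gallager P u)) has_real_derivative (\<Sum>y\<in>UNIV. D y) / gallager P u) (at u)"
    using gallager_pos[of P u] by (auto intro!: derivative_eq_intros)
  moreover have "(\<Sum>y\<in>UNIV. D y) / gallager P u = - tilted_rate P u"
    using gallager_pos[of P u]
    by (simp add: D_def tilted_rate_def sum_UNIV_prod sum_negf sum_divide_distrib)
  ultimately show ?thesis by simp
qed

text \<open>Summands with \<open>chan P a = 0\<close> vanish identically; in the others all
  arguments of \<open>ln\<close> and all denominators are positive. Continuity is what the
  intermediate value argument for small gaps rests on.\<close>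

lemma continuous_on_tilted_rate: "continuous_on {0<..} (tilted_rate P)"
proof -
  have "continuous_on {0<..} (\<lambda>u. tilted P u a * ln (tilted_ratio P u a))" for a
  proof (cases "chan P a = 0")
    case True
    then show ?thesis by (simp add: tilted_def tilted_ratio_def)
  next
    case False
    then have "pmf P (fst a, snd a) \<noteq> 0" by (auto simp: chan_def)
    then have g: "gsum P s (snd a) > 0" for s by (rule gsum_pos)
    have c: "chan P a > 0" using False chan_nonneg[of P a] by linarith
    have "isCont (\<lambda>u. gsum P (1 / u) y) u" if "u > 0" for u y
      using that by (intro isCont_o2[OF _ DERIV_isCont[OF has_real_derivative_gsum]] continuous_intros) auto
    then have cg: "continuous_on {0<..} (\<lambda>u. gsum P (1 / u) y)" for y
      by (intro continuous_at_imp_continuous_on) auto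
    have "isCont (gallager P) u" if "u > 0" for u
    proof -
      have "isCont (\<lambda>u. exp (ln (gallager P u))) u"
        using that by (intro continuous_intros DERIV_isCont[OF has_real_derivative_ln_gallager])
      then show ?thesis using gallager_pos[of P] by simp
    qed
    then have cG: "continuous_on {0<..} (gallager P)"
      by (intro continuous_at_imp_continuous_on) auto
    have "tilted_ratio P u a \<noteq> 0" for u using c g[of "1/u"] by (simp add: tilted_ratio_def)
    then show ?thesis
      unfolding tilted_def tilted_ratio_def
      using c g gallager_pos[of P]
      by (intro continuous_intros cg cG) (auto simp: less_imp_neq[symmetric])
  qed
  then show ?thesis unfolding tilted_rate_def[abs_def] by (intro continuous_on_sum)
qed

text \<open>Hoelder's inequality twice: over \<open>x\<close> with the weight \<open>\<tau>\<close>
  for which \<open>\<tau> / u + (1 - \<tau>) / v = 1 / w\<close>, then over \<open>y\<close> with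
  weight \<open>1 - t\<close>. The weights fit because
  \<open>\<tau> * w = (1 - t) * u\<close>.\<close>

lemma gallager_log_convex:
  assumes t: "0 < t" "t < 1" and "u > 0" "v > 0"
  shows "gallager P ((1 - t) * u + t * v) \<le> gallager P u powr (1 - t) * gallager P v powr t"
proof -
  define w where "w = (1 - t) * u + t * v"
  define \<tau> where "\<tau> = (1 - t) * u / w"
  have w: "w > 0" using assms by (simp add: w_def add_pos_pos)
  have \<tau>': "1 - \<tau> = t * v / w" using w by (simp add: \<tau>_def field_simps) (simp add: w_def algebra_simps)
  have \<tau>: "0 < \<tau>" "\<tau> < 1"
  proof -
    show "0 < \<tau>" using assms w by (simp add: \<tau>_def)
    have "0 < 1 - \<tau>" unfolding \<tau>' using assms w by simp
    then show "\<tau> < 1" by simp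
  qed
  have g: "gsum P (1 / w) y powr w \<le> (gsum P (1 / u) y powr u) powr (1 - t) * (gsum P (1 / v) y powr v) powr (1 - (1 - t))" for y
  proof -
    have "pmf (marg_X P) x * chan P (x, y) powr (1 / w) =
        (pmf (marg_X P) x * chan P (x, y) powr (1 / u)) powr \<tau> * (pmf (marg_X P) x * chan P (x, y) powr (1 / v)) powr (1 - \<tau>)" for x
    proof (cases "pmf (marg_X P) x = 0 \<or> chan P (x, y) = 0")
      case False
      then have c: "pmf (marg_X P) x > 0" "chan P (x, y) > 0"
        using chan_nonneg[of P "(x, y)"] pmf_nonneg[of "marg_X P" x] by linarith+
      have e: "\<tau> / u + (1 - \<tau>) / v = 1 / w"
        unfolding \<tau>' using assms w by (simp add: \<tau>_def field_simps)
      have "(pmf (marg_X P) x * chan P (x, y) powr (1 / u)) powr \<tau> * (pmf (marg_X P) x * chan P (x, y) powr (1 / v)) powr (1 - \<tau>)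
        = (pmf (marg_X P) x powr \<tau> * pmf (marg_X P) x powr (1 - \<tau>)) * (chan P (x, y) powr (\<tau> / u) * chan P (x, y) powr ((1 - \<tau>) / v))"
        using c by (simp add: powr_mult powr_powr)
      also have "\<dots> = pmf (marg_X P) x powr 1 * chan P (x, y) powr (1 / w)"
        unfolding powr_add[symmetric] e by simp
      finally show ?thesis using c by simp
    qed auto
    then have "gsum P (1 / w) y \<le> gsum P (1 / u) y powr \<tau> * gsum P (1 / v) y powr (1 - \<tau>)"
      unfolding gsum_def using \<tau> by (simp only:) (intro holder_powr_sum, auto)
    then have "gsum P (1 / w) y powr w \<le> (gsum P (1 / u) y powr \<tau> * gsum P (1 / v) y powr (1 - \<tau>)) powr w"
      using w by (intro powr_mono2) auto
    also have "\<dots> = gsum P (1 / u) y powr (\<tau> * w) * gsum P (1 / v) y powr ((1 - \<tau>) * w)"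
      by (simp add: powr_mult powr_powr)
    also have "\<tau> * w = u * (1 - t)" using w by (simp add: \<tau>_def)
    also have "(1 - \<tau>) * w = v * t" unfolding \<tau>' using w by simp
    finally show ?thesis by (simp add: powr_powr)
  qed
  have "gallager P w \<le> (\<Sum>y\<in>UNIV. (gsum P (1 / u) y powr u) powr (1 - t) * (gsum P (1 / v) y powr v) powr (1 - (1 - t)))"
    unfolding gallager_def by (intro sum_mono g)
  also have "\<dots> \<le> gallager P u powr (1 - t) * gallager P v powr (1 - (1 - t))"
    unfolding gallager_def using t by (intro holder_powr_sum) auto
  finally show ?thesis by (simp add: w_def)
qed

lemma convex_on_ln_gallager: "convex_on {0<..} (\<lambda>u. ln (gallager P u))"
proof (rule convex_onI)
  fix t u v :: real assume *: "0 < t" "t < 1" "u \<in> {0<..}" "v \<in> {0<..}"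
  have "ln (gallager P ((1 - t) * u + t * v)) \<le> ln (gallager P u powr (1 - t) * gallager P v powr t)"
    using gallager_log_convex[of t u v] * gallager_pos[of P]
    by (subst ln_le_cancel_iff) (auto simp: gallager_nonzero)
  also have "\<dots> = (1 - t) * ln (gallager P u) + t * ln (gallager P v)"
    using gallager_pos[of P] by (simp add: ln_mult ln_powr less_imp_neq[symmetric])
  finally show "ln (gallager P ((1 - t) *\<^sub>R u + t *\<^sub>R v)) \<le> (1 - t) * ln (gallager P u) + t * ln (gallager P v)"
    by simp
qed simp

text \<open>Minus the derivative of a convex function is antitone: add the tangent inequalities at
  \<open>u\<close> and at \<open>v\<close>.\<close>

lemma tilted_rate_antimono:
  assumes "0 < u" "u \<le> v"
  shows "tilted_rate P v \<le> tilted_rate P u"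
proof -
  have tangent: "ln (gallager P y) - ln (gallager P x) \<ge> - tilted_rate P x * (y - x)" if "x > 0" "y > 0" for x y
    using that has_real_derivative_ln_gallager[of x]
    by (intro convex_on_imp_above_tangent[OF convex_on_ln_gallager])
      (auto simp: interior_open has_field_derivative_at_within)
  have "(tilted_rate P u - tilted_rate P v) * (v - u) \<ge> 0"
    using tangent[of u v] tangent[of v u] assms by (simp add: algebra_simps)
  then show ?thesis using assms by (cases "u = v") (auto simp: zero_le_mult_iff)
qed

section \<open>The untilted point \<open>u = 1\<close>\<close>

lemma gsum_1: "gsum P 1 y = pmf (marg_Y P) y"
  by (simp add: gsum_def sum_pmf_X[symmetric] pmf_eq_chan)

lemma gallager_1: "gallager P 1 = 1"
  by (simp add: gallager_def gsum_1 sum_pmf_eq_1)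

lemma tilted_1: "tilted P 1 a = pmf P a"
  using pmf_eq_tilted[of 1 P a] by (cases "tilted_ratio P 1 a = 0") (auto simp: gallager_1 tilted_def)

text \<open>At \<open>u = 1\<close> the tilted distribution is \<open>P\<close>, and on its support
  the ratio is the density of \<open>P\<close> with respect to the product of its marginals;
  \<open>ln b\<close> converts nats to base \<open>b\<close>.\<close>

lemma mutual_info_eq:
  assumes "b > 1"
  shows "mutual_info b P = ereal (tilted_rate P 1 / ln b)"
proof -
  have supp: "set_pmf P \<subseteq> set_pmf (pair_pmf (marg_X P) (marg_Y P))" by force
  have "pmf P a * (log b (pmf P a) - log b (pmf (pair_pmf (marg_X P) (marg_Y P)) a)) =
      tilted P 1 a * ln (tilted_ratio P 1 a) / ln b" if "a \<in> set_pmf P" for a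
  proof -
    have pos: "pmf P a > 0" "pmf (marg_X P) (fst a) > 0" "pmf (marg_Y P) (snd a) > 0"
      using that by (auto simp: pmf_positive)
    have "tilted_ratio P 1 a = pmf P a / pmf (pair_pmf (marg_X P) (marg_Y P)) a"
      using pos by (cases a) (simp add: tilted_ratio_def gsum_1 pmf_pair chan_def)
    moreover have "pmf (pair_pmf (marg_X P) (marg_Y P)) a > 0"
      using that supp by (intro pmf_positive) auto
    ultimately show ?thesis
      using pos by (simp add: tilted_1 log_def ln_div diff_divide_distrib right_diff_distrib)
  qed
  then have "(\<Sum>a\<in>set_pmf P. pmf P a * (log b (pmf P a) - log b (pmf (pair_pmf (marg_X P) (marg_Y P)) a)))
      = (\<Sum>a\<in>set_pmf P. tilted P 1 a * ln (tilted_ratio P 1 a)) / ln b"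
    by (simp add: sum_divide_distrib)
  also have "(\<Sum>a\<in>set_pmf P. tilted P 1 a * ln (tilted_ratio P 1 a)) = tilted_rate P 1"
    unfolding tilted_rate_def by (intro sum.mono_neutral_left) (auto simp: tilted_1 set_pmf_eq)
  finally show ?thesis
    using supp by (simp add: mutual_info_def renyi_div_def)
qed


section \<open>Sibson's identity\<close>

text \<open>The exponents \<open>s\<close> and \<open>1 - s\<close> of the \<open>X\<close>-marginal
  add up to 1. What remains is an optimisation over \<open>Q\<close> alone, with coefficients
  \<open>gsum P s\<close>.\<close>

lemma renyi_sum_eq:
  fixes Q :: "'y pmf"
  assumes "s > 0"
  shows "(\<Sum>a\<in>set_pmf P. pmf P a powr s * pmf (pair_pmf (marg_X P) Q) a powr (1 - s)) =
    (\<Sum>y\<in>UNIV. gsum P s y * pmf Q y powr (1 - s))"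
proof -
  have "pmf P (x, y) powr s * pmf (pair_pmf (marg_X P) Q) (x, y) powr (1 - s) =
      pmf (marg_X P) x * chan P (x, y) powr s * pmf Q y powr (1 - s)" for x y
  proof (cases "pmf (marg_X P) x = 0")
    case False
    then have "pmf (marg_X P) x powr s * pmf (marg_X P) x powr (1 - s) = pmf (marg_X P) x"
      by (simp add: powr_add[symmetric])
    then show ?thesis
      by (simp add: pmf_pair powr_mult pmf_eq_chan[of P "(x, y)"] mult_ac)
  qed (simp add: pmf_eq_chan)
  then have "(\<Sum>y\<in>UNIV. gsum P s y * pmf Q y powr (1 - s)) =
      (\<Sum>a\<in>UNIV. pmf P a powr s * pmf (pair_pmf (marg_X P) Q) a powr (1 - s))"
    unfolding sum_UNIV_prod by (simp add: gsum_def sum_distrib_right)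
  also have "\<dots> = (\<Sum>a\<in>set_pmf P. pmf P a powr s * pmf (pair_pmf (marg_X P) Q) a powr (1 - s))"
    by (intro sum.mono_neutral_right) (auto simp: set_pmf_eq)
  finally show ?thesis by simp
qed

text \<open>The minimiser is proportional to \<open>gsum P s y powr (1 / s)\<close>. Optimality is
  Hoelder's inequality: it gives \<open>S Q' \<le> Z powr s\<close> for \<open>s < 1\<close> and the
  reverse for \<open>s > 1\<close>, matching the sign of \<open>1 / (s - 1)\<close>.\<close>

lemma renyi_minimizer:
  assumes b: "b > 1" and s: "s > 0" "s \<noteq> 1"
  shows "\<exists>Q. renyi_div b s P (pair_pmf (marg_X P) Q) = ereal (s / (s - 1) * (ln (gallager P (1 / s)) / ln b)) \<and>
    (\<forall>Q'. renyi_div b s P (pair_pmf (marg_X P) Q) \<le> renyi_div b s P (pair_pmf (marg_X P) Q'))"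
proof -
  define Z where "Z = gallager P (1 / s)"
  define S where "S Q = (\<Sum>y\<in>UNIV. gsum P s y * pmf Q y powr (1 - s))" for Q :: "'y pmf"
  have Z: "Z > 0" unfolding Z_def by (rule gallager_pos)
  have Z_eq: "Z = (\<Sum>y\<in>UNIV. gsum P s y powr (1 / s))" by (simp add: Z_def gallager_def)
  have div: "renyi_div b s P (pair_pmf (marg_X P) Q) =
      (if s \<ge> 1 \<and> \<not> set_pmf P \<subseteq> set_pmf (pair_pmf (marg_X P) Q) \<or> S Q = 0 then \<infinity>
       else ereal (1 / (s - 1) * log b (S Q)))" for Q
    using s by (simp add: renyi_div_def S_def renyi_sum_eq Let_def)
  have "(\<integral>\<^sup>+y. ennreal (gsum P s y powr (1 / s) / Z) \<partial>count_space UNIV) = ennreal (\<Sum>y\<in>UNIV. gsum P s y powr (1 / s) / Z)"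
    using Z by (simp add: nn_integral_count_space_finite sum_ennreal)
  also have "\<dots> = 1" using Z by (simp add: sum_divide_distrib[symmetric] Z_eq[symmetric])
  finally have int: "(\<integral>\<^sup>+y. ennreal (gsum P s y powr (1 / s) / Z) \<partial>count_space UNIV) = 1" .
  define Q where "Q = embed_pmf (\<lambda>y. gsum P s y powr (1 / s) / Z)"
  have Q: "pmf Q y = gsum P s y powr (1 / s) / Z" for y
    unfolding Q_def using Z int by (intro pmf_embed_pmf) auto
  have "gsum P s y * pmf Q y powr (1 - s) = gsum P s y powr (1 / s) * Z powr (s - 1)" for y
  proof (cases "gsum P s y = 0")
    case False
    then have g: "gsum P s y > 0" using gsum_nonneg[of P s y] by linarith
    have "gsum P s y * pmf Q y powr (1 - s) = gsum P s y powr 1 * (gsum P s y powr (1 / s * (1 - s)) * Z powr (- (1 - s)))"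
      using g Z by (simp add: Q powr_divide powr_powr powr_minus_divide del: minus_diff_eq)
    also have "\<dots> = gsum P s y powr (1 + 1 / s * (1 - s)) * Z powr (- (1 - s))"
      unfolding powr_add by simp
    also have "1 + 1 / s * (1 - s) = 1 / s" using s by (simp add: field_simps)
    finally show ?thesis by simp
  qed simp
  then have "S Q = Z powr 1 * Z powr (s - 1)"
    using Z by (simp add: S_def sum_distrib_right[symmetric] Z_eq[symmetric])
  then have SQ: "S Q = Z powr s" by (simp only: powr_add[symmetric]) simp
  have supp: "set_pmf P \<subseteq> set_pmf (pair_pmf (marg_X P) Q)"
  proof
    fix a assume a: "a \<in> set_pmf P"
    then have "gsum P s (snd a) > 0" by (subst gsum_pos_iff) auto
    then have "snd a \<in> set_pmf Q" using Z by (simp add: set_pmf_eq Q)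
    with a show "a \<in> set_pmf (pair_pmf (marg_X P) Q)" by (cases a) force
  qed
  have val: "renyi_div b s P (pair_pmf (marg_X P) Q) = ereal (1 / (s - 1) * log b (Z powr s))"
    using supp Z by (simp add: div SQ)
  have le: "renyi_div b s P (pair_pmf (marg_X P) Q) \<le> renyi_div b s P (pair_pmf (marg_X P) Q')" for Q'
  proof (cases "s < 1")
    case True
    have "S Q' = (\<Sum>y\<in>UNIV. (gsum P s y powr (1 / s)) powr s * pmf Q' y powr (1 - s))"
      unfolding S_def using s by (intro sum.cong) (simp_all add: powr_powr)
    also have "\<dots> \<le> Z powr s * (\<Sum>y\<in>UNIV. pmf Q' y) powr (1 - s)"
      unfolding Z_eq using s True by (intro holder_powr_sum) auto
    finally have "S Q' \<le> Z powr s" by (simp add: sum_pmf_eq_1)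
    moreover have "S Q' \<ge> 0" unfolding S_def by (intro sum_nonneg) auto
    ultimately show ?thesis
      unfolding val unfolding div using True b Z
      by (auto intro!: divide_right_mono_neg simp: log_le_cancel_iff)
  next
    case False
    with s have s1: "s > 1" by simp
    show ?thesis
    proof (cases "set_pmf P \<subseteq> set_pmf (pair_pmf (marg_X P) Q')")
      case True
      \<comment> \<open>Insert powers of \<open>pmf Q' y\<close> that cancel, to prepare for
        Hoelder's inequality with weight \<open>1 / s\<close>. They cancel because the support
        condition makes \<open>pmf Q' y\<close> positive wherever \<open>gsum\<close> is.\<close>
      have "Z = (\<Sum>y\<in>UNIV. (gsum P s y * pmf Q' y powr (1 - s)) powr (1 / s) * pmf Q' y powr (1 - 1 / s))"
        unfolding Z_eq
      proof (intro sum.cong refl)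
        fix y
        show "gsum P s y powr (1 / s) = (gsum P s y * pmf Q' y powr (1 - s)) powr (1 / s) * pmf Q' y powr (1 - 1 / s)"
        proof (cases "gsum P s y = 0")
          case False
          then have "y \<in> set_pmf (marg_Y P)" using gsum_nonneg[of P s y] by (subst gsum_pos_iff[where P = P and s = s, symmetric]) linarith
          then obtain x where "(x, y) \<in> set_pmf P" by auto
          with True have q: "pmf Q' y > 0" by (auto simp: pmf_positive)
          have "(gsum P s y * pmf Q' y powr (1 - s)) powr (1 / s) * pmf Q' y powr (1 - 1 / s) =
              gsum P s y powr (1 / s) * (pmf Q' y powr ((1 - s) / s) * pmf Q' y powr (1 - 1 / s))"
            using q by (simp add: powr_mult powr_powr)
          also have "pmf Q' y powr ((1 - s) / s) * pmf Q' y powr (1 - 1 / s) = pmf Q' y powr ((1 - s) / s + (1 - 1 / s))"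
            by (rule powr_add[symmetric])
          also have "(1 - s) / s + (1 - 1 / s) = 0" using s by (simp add: field_simps)
          finally show ?thesis using q by simp
        qed simp
      qed
      also have "\<dots> \<le> S Q' powr (1 / s) * (\<Sum>y\<in>UNIV. pmf Q' y) powr (1 - 1 / s)"
        unfolding S_def using s1 by (intro holder_powr_sum) auto
      finally have ZS: "Z \<le> S Q' powr (1 / s)" by (simp add: sum_pmf_eq_1)
      have S0: "S Q' > 0"
      proof -
        have "S Q' \<noteq> 0" using ZS Z by auto
        moreover have "S Q' \<ge> 0" unfolding S_def by (intro sum_nonneg) auto
        ultimately show ?thesis by simp
      qed
      have "Z powr s \<le> (S Q' powr (1 / s)) powr s" using ZS Z s by (intro powr_mono2) auto
      then have "Z powr s \<le> S Q'" using S0 s by (simp add: powr_powr)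
      then show ?thesis
        unfolding val unfolding div using True b Z S0 s1
        by (auto intro!: divide_right_mono simp: log_le_cancel_iff)
    qed (use s1 in \<open>simp add: div\<close>)
  qed
  show ?thesis
  proof (intro exI[of _ Q] conjI allI)
    show "renyi_div b s P (pair_pmf (marg_X P) Q) = ereal (s / (s - 1) * (ln (gallager P (1 / s)) / ln b))"
      unfolding val using Z by (simp add: log_def ln_powr Z_def)
  qed (rule le)
qed

text \<open>When the right side is finite, the two sides differ by the divergence of the
  \<open>Y\<close>-marginal from \<open>Q\<close>, whose nonnegativity follows from
  \<open>ln z \<le> z - 1\<close>.\<close>

lemma mutual_info_minimizer:
  assumes b: "b > 1"
  shows "mutual_info b P \<le> renyi_div b 1 P (pair_pmf (marg_X P) Q)"
proof (cases "set_pmf P \<subseteq> set_pmf (pair_pmf (marg_X P) Q)")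
  case True
  let ?R = "pair_pmf (marg_X P) (marg_Y P)" and ?Q = "pair_pmf (marg_X P) Q"
  have supp: "set_pmf P \<subseteq> set_pmf ?R" by force
  have summand_le: "pmf P a * (log b (pmf P a) - log b (pmf ?R a)) + pmf P a * (1 - pmf Q (snd a) / pmf (marg_Y P) (snd a)) / ln b
      \<le> pmf P a * (log b (pmf P a) - log b (pmf ?Q a))" if "a \<in> set_pmf P" for a
  proof -
    have pos: "pmf (marg_X P) (fst a) > 0" "pmf (marg_Y P) (snd a) > 0" "pmf Q (snd a) > 0"
    proof -
      have "fst a \<in> set_pmf (marg_X P)" "snd a \<in> set_pmf (marg_Y P)" using that by auto
      moreover have "snd a \<in> set_pmf Q" using that True by (cases a) auto
      ultimately show "pmf (marg_X P) (fst a) > 0" "pmf (marg_Y P) (snd a) > 0" "pmf Q (snd a) > 0"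
        by (auto intro: pmf_positive simp del: set_map_pmf)
    qed
    have "ln (pmf Q (snd a) / pmf (marg_Y P) (snd a)) \<le> pmf Q (snd a) / pmf (marg_Y P) (snd a) - 1"
      using pos by (intro ln_le_minus_one) auto
    then have "1 - pmf Q (snd a) / pmf (marg_Y P) (snd a) \<le> ln (pmf ?R a) - ln (pmf ?Q a)"
      using pos by (cases a) (simp add: ln_div ln_mult pmf_pair)
    then have "(1 - pmf Q (snd a) / pmf (marg_Y P) (snd a)) / ln b \<le> log b (pmf ?R a) - log b (pmf ?Q a)"
      unfolding log_def diff_divide_distrib[symmetric] using b by (intro divide_right_mono) auto
    then have "pmf P a * ((1 - pmf Q (snd a) / pmf (marg_Y P) (snd a)) / ln b) \<le> pmf P a * (log b (pmf ?R a) - log b (pmf ?Q a))"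
      by (intro mult_left_mono) auto
    then show ?thesis by (simp add: algebra_simps)
  qed
  have "(\<Sum>a\<in>set_pmf P. pmf P a * (pmf Q (snd a) / pmf (marg_Y P) (snd a)))
      = (\<Sum>a\<in>UNIV. pmf P a * (pmf Q (snd a) / pmf (marg_Y P) (snd a)))"
    by (intro sum.mono_neutral_left) (auto simp: set_pmf_eq)
  also have "\<dots> = (\<Sum>y\<in>UNIV. pmf (marg_Y P) y * (pmf Q y / pmf (marg_Y P) y))"
    unfolding sum_UNIV_prod by (simp only: snd_conv sum_distrib_right[symmetric] sum_pmf_X)
  \<comment> \<open>An inequality only, as \<open>Q\<close> may have mass outside the support of the
    \<open>Y\<close>-marginal.\<close>
  also have "\<dots> \<le> (\<Sum>y\<in>UNIV. pmf Q y)" by (intro sum_mono) auto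
  finally have "(\<Sum>a\<in>set_pmf P. pmf P a * (pmf Q (snd a) / pmf (marg_Y P) (snd a))) \<le> 1"
    by (simp add: sum_pmf_eq_1)
  then have "0 \<le> (\<Sum>a\<in>set_pmf P. pmf P a * (1 - pmf Q (snd a) / pmf (marg_Y P) (snd a))) / ln b"
    using b by (simp add: right_diff_distrib sum_subtractf sum_pmf_eq_1)
  also have "\<dots> + (\<Sum>a\<in>set_pmf P. pmf P a * (log b (pmf P a) - log b (pmf ?R a)))
      = (\<Sum>a\<in>set_pmf P. pmf P a * (log b (pmf P a) - log b (pmf ?R a)) + pmf P a * (1 - pmf Q (snd a) / pmf (marg_Y P) (snd a)) / ln b)"
    by (simp add: sum.distrib sum_divide_distrib)
  also have "\<dots> \<le> (\<Sum>a\<in>set_pmf P. pmf P a * (log b (pmf P a) - log b (pmf ?Q a)))"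
    by (rule sum_mono[OF summand_le])
  finally show ?thesis
    using True supp by (simp add: mutual_info_def renyi_div_def)
qed (simp add: renyi_div_def)

lemma renyi_mutual_info_eqI:
  assumes "\<And>Q'. renyi_div b s P (pair_pmf (marg_X P) Q) \<le> renyi_div b s P (pair_pmf (marg_X P) Q')"
  shows "renyi_mutual_info b s P = renyi_div b s P (pair_pmf (marg_X P) Q)"
  unfolding renyi_mutual_info_def using assms by (intro antisym INF_lower INF_greatest) auto

lemma renyi_mutual_info_1:
  assumes "b > 1"
  shows "renyi_mutual_info b 1 P = mutual_info b P"
  unfolding mutual_info_def
  by (rule renyi_mutual_info_eqI) (rule mutual_info_minimizer[OF assms, unfolded mutual_info_def])

lemma renyi_mutual_info_eq:
  assumes "b > 1" "s > 0" "s \<noteq> 1"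
  shows "renyi_mutual_info b s P = ereal (s / (s - 1) * (ln (gallager P (1 / s)) / ln b))"
proof -
  obtain Q where Q: "renyi_div b s P (pair_pmf (marg_X P) Q) = ereal (s / (s - 1) * (ln (gallager P (1 / s)) / ln b))"
    "\<And>Q'. renyi_div b s P (pair_pmf (marg_X P) Q) \<le> renyi_div b s P (pair_pmf (marg_X P) Q')"
    using renyi_minimizer[OF assms] by blast
  from renyi_mutual_info_eqI[OF Q(2)] Q(1) show ?thesis by simp
qed

lemma renyi_mutual_info_attained:
  assumes "b > 1" "s > 0"
  shows "\<bar>renyi_mutual_info b s P\<bar> \<noteq> \<infinity> \<and>
    (\<exists>Q. renyi_mutual_info b s P = renyi_div b s P (pair_pmf (marg_X P) Q))"
proof (cases "s = 1")
  case True
  have "renyi_mutual_info b 1 P = renyi_div b 1 P (pair_pmf (marg_X P) (marg_Y P))"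
    by (simp add: renyi_mutual_info_1[OF assms(1)] mutual_info_def)
  moreover have "\<bar>renyi_mutual_info b 1 P\<bar> \<noteq> \<infinity>"
    by (simp add: renyi_mutual_info_1[OF assms(1)] mutual_info_eq[OF assms(1)])
  ultimately show ?thesis unfolding True by (intro conjI exI)
next
  case False
  obtain Q where Q: "\<And>Q'. renyi_div b s P (pair_pmf (marg_X P) Q) \<le> renyi_div b s P (pair_pmf (marg_X P) Q')"
    using renyi_minimizer[OF assms False] by blast
  have "\<bar>renyi_mutual_info b s P\<bar> \<noteq> \<infinity>" by (simp add: renyi_mutual_info_eq[OF assms False])
  with renyi_mutual_info_eqI[OF Q] show ?thesis by blast
qed

text \<open>At \<open>s = 1\<close>, which Sibson's identity leaves out, both sides are 0 as
  \<open>gallager P 1 = 1\<close>. Thus a single formula can be differentiated on the whole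
  half-line.\<close>

lemma phi_eq:
  assumes "b > 1" "s > 0"
  shows "phi b P s = s * ln (gallager P (1 / s)) / ln b"
  using assms by (cases "s = 1") (simp_all add: phi_def gallager_1 renyi_mutual_info_eq)

lemma has_real_derivative_phi:
  assumes b: "b > 1" and s: "s > 0"
  shows "(phi b P has_real_derivative (ln (gallager P (1 / s)) + tilted_rate P (1 / s) / s) / ln b) (at s)"
proof -
  have "((\<lambda>s. ln (gallager P (1 / s))) has_real_derivative - tilted_rate P (1 / s) * (- 1 / s\<^sup>2)) (at s)"
    using s by (intro DERIV_chain2[OF has_real_derivative_ln_gallager])
      (auto intro!: derivative_eq_intros simp: power2_eq_square)
  then have "((\<lambda>s. s * ln (gallager P (1 / s)) / ln b) has_real_derivative
      (ln (gallager P (1 / s)) + tilted_rate P (1 / s) / s) / ln b) (at s)"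
    by (intro DERIV_cong[OF DERIV_cdivide[OF DERIV_mult[OF DERIV_ident]]])
      (use s b in \<open>auto simp: power2_eq_square field_simps\<close>)
  then show ?thesis
    by (rule has_field_derivative_transform_within_open[of _ _ _ "{0<..}"]) (use s b in \<open>auto simp: phi_eq\<close>)
qed

text \<open>The terms with \<open>ln (gallager P (1 / s))\<close> cancel. The limits defining
  \<open>R_zero\<close> and \<open>R_infty\<close> become those of
  \<open>tilted_rate P u / ln b\<close> as \<open>u\<close> tends to infinity and to 0.\<close>

lemma phi_legendre:
  assumes "b > 1" "s > 0"
  shows "s * deriv (phi b P) s - phi b P s = tilted_rate P (1 / s) / ln b"
  using assms by (simp add: DERIV_imp_deriv[OF has_real_derivative_phi] phi_eq field_simps)

end


section \<open>Exponents\<close>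

lemma le_neg_log:
  assumes "b > 1" "n > 0" "0 \<le> x" "x \<le> b powr (- real n * c)"
  shows "ereal c \<le> ereal (1 / real n) * neg_log b x"
proof (cases "x = 0")
  case False
  with assms have "log b x \<le> - real n * c" by (simp add: log_le_iff)
  then have "c \<le> 1 / real n * - log b x" using assms by (simp add: field_simps)
  with False show ?thesis by (simp add: neg_log_def)
qed (use assms in \<open>simp add: neg_log_def\<close>)

text \<open>The factor \<open>1 / 2\<close> from the change of measure costs
  \<open>log b 2 / real n\<close>, which vanishes in the limit.\<close>

lemma neg_log_le:
  assumes "b > 1" "n > 0" "1 / 2 * b powr (- real n * c) \<le> x"
  shows "ereal (1 / real n) * neg_log b x \<le> ereal (c + log b 2 / real n)"
proof -
  have pos: "0 < 1 / 2 * b powr (- real n * c)" using assms by simp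
  with assms have x: "x > 0" by linarith
  have "log b (1 / 2 * b powr (- real n * c)) \<le> log b x"
    using assms pos x by (subst log_le_cancel_iff) auto
  also have "log b (1 / 2 * b powr (- real n * c)) = - log b 2 - real n * c"
    using assms by (simp add: log_mult log_divide)
  finally have "1 / real n * - log b x \<le> c + log b 2 / real n"
    using assms by (simp add: field_simps)
  with x show ?thesis by (simp add: neg_log_def)
qed

lemma le_liminf_neg_log:
  assumes "b > 1" "\<And>n. 0 \<le> x n" "\<And>n. x n \<le> b powr (- real n * c)"
  shows "ereal c \<le> liminf (\<lambda>n. ereal (1 / real n) * neg_log b (x n))"
proof (rule Liminf_bounded)
  show "\<forall>\<^sub>F n in sequentially. ereal c \<le> ereal (1 / real n) * neg_log b (x n)"
    using eventually_gt_at_top[of 0] by eventually_elim (intro le_neg_log assms)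
qed

lemma limsup_neg_log_le:
  assumes b: "b > 1" and "\<forall>\<^sub>F n in sequentially. 1 / 2 * b powr (- real n * c) \<le> x n"
  shows "limsup (\<lambda>n. ereal (1 / real n) * neg_log b (x n)) \<le> ereal c"
proof -
  have "\<forall>\<^sub>F n in sequentially. ereal (1 / real n) * neg_log b (x n) \<le> ereal (c + log b 2 / real n)"
    using assms(2) eventually_gt_at_top[of 0] by eventually_elim (rule neg_log_le[OF b])
  then have "limsup (\<lambda>n. ereal (1 / real n) * neg_log b (x n)) \<le> limsup (\<lambda>n. ereal (c + log b 2 / real n))"
    by (rule Limsup_mono)
  also have "((\<lambda>n. c + log b 2 / real n) \<longlongrightarrow> c + 0) sequentially"
    by (intro tendsto_intros tendsto_divide_0[OF tendsto_const] filterlim_real_sequentially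
        filterlim_at_top_imp_at_infinity)
  then have "limsup (\<lambda>n. ereal (c + log b 2 / real n)) = ereal c"
    by (intro lim_imp_Limsup) auto
  finally show ?thesis .
qed

section \<open>Limits of monotone functions\<close>

lemma tendsto_at_right_INF:
  fixes f :: "real \<Rightarrow> ereal"
  assumes mono: "\<And>x y. 0 < x \<Longrightarrow> x \<le> y \<Longrightarrow> f x \<le> f y"
  shows "(f \<longlongrightarrow> (INF x\<in>{0<..}. f x)) (at_right 0)"
proof (rule decreasing_tendsto)
  show "\<forall>\<^sub>F x in at_right 0. (INF x\<in>{0<..}. f x) \<le> f x"
    using eventually_at_right_less[of 0] by eventually_elim (auto intro: INF_lower)
  fix l assume "(INF x\<in>{0<..}. f x) < l"
  then obtain z where z: "z > 0" "f z < l" by (auto simp: INF_less_iff)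
  have "\<forall>\<^sub>F x in at_right 0. x \<in> {0<..<z}" using z(1) by (rule eventually_at_right_real)
  then show "\<forall>\<^sub>F x in at_right 0. f x < l"
  proof eventually_elim
    case (elim x)
    then show ?case using mono[of x z] z by auto
  qed
qed

lemma tendsto_at_top_SUP:
  fixes f :: "real \<Rightarrow> ereal"
  assumes mono: "\<And>x y. 0 < x \<Longrightarrow> x \<le> y \<Longrightarrow> f x \<le> f y"
  shows "(f \<longlongrightarrow> (SUP x\<in>{0<..}. f x)) at_top"
proof (rule increasing_tendsto)
  show "\<forall>\<^sub>F x in at_top. f x \<le> (SUP x\<in>{0<..}. f x)"
    using eventually_gt_at_top[of 0] by eventually_elim (auto intro: SUP_upper)
  fix l assume "l < (SUP x\<in>{0<..}. f x)"
  then obtain z where z: "z > 0" "l < f z" by (auto simp: less_SUP_iff)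
  show "\<forall>\<^sub>F x in at_top. l < f x"
    using eventually_ge_at_top[of z]
  proof eventually_elim
    case (elim x)
    then show ?case using mono[of z x] z by auto
  qed
qed

context
  fixes P :: "('x::finite \<times> 'y::finite) pmf" and b :: real
  assumes b: "b > 1"
begin

abbreviation opt_error :: "real \<Rightarrow> nat \<Rightarrow> real" where
  "opt_error \<equiv> opt_type1_at_rate b P (indep_alternatives P)"

text \<open>With \<open>u = 1 / s\<close>, both exponents maximise the same function, over \<open>u > 1\<close> and over \<open>u < 1\<close>.\<close>

definition exponent_at :: "real \<Rightarrow> real \<Rightarrow> real" where
  "exponent_at R u = (1 - u) * R - ln (gallager P u) / ln b"

text \<open>The rate \<open>R\<close> for which \<open>u\<close> is a stationary point of
  \<open>exponent_at R\<close>.\<close>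

definition critical_rate :: "real \<Rightarrow> real" where
  "critical_rate u = tilted_rate P u / ln b"

lemma ln_base_pos: "ln b > 0"
  using b by simp

lemma base_powr: "b powr (real n * R) = exp (real n * (R * ln b))"
  using b by (simp add: powr_def mult_ac)

lemma opt_type1_at_rate_range: "0 \<le> opt_error R n" "opt_error R n \<le> 1"
proof -
  obtain T where T: "feasible_test P n (b powr (- real n * R)) T"
    "opt_error R n = (\<Sum>as\<in>words n. prod_list (map (pmf P) as) * (1 - T as))"
    using opt_type1_indep_alternatives_attained[of "b powr (- real n * R)" P n]
    unfolding opt_type1_at_rate_def by auto
  from T(1) have T01: "0 \<le> T as" "T as \<le> 1" if "as \<in> words n" for as
    using that by (auto simp: feasible_test_def)
  show "0 \<le> opt_error R n"
    unfolding T(2) using T01 by (intro sum_nonneg mult_nonneg_nonneg prod_list_map_nonneg) auto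
  have "opt_error R n \<le> (\<Sum>as\<in>words n. prod_list (map (pmf P) as))"
    unfolding T(2) using T01 by (intro sum_mono mult_left_le prod_list_map_nonneg) auto
  then show "opt_error R n \<le> 1" by (simp add: sum_words_pmf)
qed

lemma gallager_powr_eq:
  "gallager P u ^ n * (b powr (- real n * R)) powr (1 - u) = b powr (- real n * exponent_at R u)"
proof -
  have "gallager P u ^ n = exp (n * ln (gallager P u))"
    using gallager_pos[of P u] by (simp add: exp_of_nat_mult)
  then show ?thesis
    using b by (simp add: powr_def exponent_at_def mult_exp_exp field_simps)
qed

lemma opt_type1_at_rate_le:
  assumes "u > 1"
  shows "opt_error R n \<le> b powr (- real n * exponent_at R u)"
  using opt_type1_direct[where P = P and s = "1 / u" and \<mu> = "b powr (- real n * R)" and n = n] assms b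
  unfolding opt_type1_at_rate_def gallager_powr_eq[symmetric] by simp

lemma one_minus_opt_type1_at_rate_le:
  assumes "0 < u" "u < 1"
  shows "1 - opt_error R n \<le> b powr (- real n * exponent_at R u)"
  using opt_type1_strong_converse[where P = P and s = "1 / u" and \<mu> = "b powr (- real n * R)" and n = n] assms b
  unfolding opt_type1_at_rate_def gallager_powr_eq[symmetric] by simp

text \<open>The slack \<open>\<delta> * ln b / (u - 1)\<close> is scaled to become exactly
  \<open>\<delta>\<close> in the exponent to base \<open>b\<close>; for \<open>u < 1\<close> it is
  negative, as the bound there requires.\<close>

lemma gallager_exp_eq:
  "gallager P u ^ n * exp (n * (tilted_rate P u - \<delta> * ln b / (u - 1)) * (u - 1)) =
    b powr (- real n * (exponent_at R u + (u - 1) * (R - critical_rate u) + \<delta>))" if "u \<noteq> 1"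
proof -
  have "gallager P u ^ n = exp (n * ln (gallager P u))"
    using gallager_pos[of P u] by (simp add: exp_of_nat_mult)
  then show ?thesis
    using b that by (simp add: powr_def exponent_at_def critical_rate_def mult_exp_exp field_simps)
qed

lemma opt_type1_at_rate_ge:
  assumes u: "u > 1" and "critical_rate u < R" "\<delta> > 0"
  shows "\<forall>\<^sub>F n in sequentially.
    1 / 2 * b powr (- real n * (exponent_at R u + (u - 1) * (R - critical_rate u) + \<delta>)) \<le> opt_error R n"
proof -
  have "tilted_rate P u < R * ln b" "\<delta> * ln b / (u - 1) > 0"
    using assms ln_base_pos by (auto simp: critical_rate_def field_simps)
  from opt_type1_converse[OF u this] show ?thesis
    using u gallager_exp_eq[of u _ \<delta> R] base_powr[of _ "- R"]
    by (simp add: opt_type1_at_rate_def)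
qed

lemma one_minus_opt_type1_at_rate_ge:
  assumes u: "0 < u" "u < 1" and "R < critical_rate u" "\<delta> > 0"
  shows "\<forall>\<^sub>F n in sequentially.
    1 / 2 * b powr (- real n * (exponent_at R u + (u - 1) * (R - critical_rate u) + \<delta>)) \<le> 1 - opt_error R n"
proof -
  have "R * ln b < tilted_rate P u" "\<delta> * ln b / (1 - u) > 0"
    using assms ln_base_pos by (auto simp: critical_rate_def field_simps)
  note * = opt_type1_achievable[OF u this]
  have "tilted_rate P u + \<delta> * ln b / (1 - u) = tilted_rate P u - \<delta> * ln b / (u - 1)"
    by (metis diff_minus_eq_add minus_diff_eq minus_divide_right)
  with * show ?thesis
    using u gallager_exp_eq[of u _ \<delta> R] base_powr[of _ "- R"]
    by (simp add: opt_type1_at_rate_def)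
qed

lemma continuous_on_critical_rate: "continuous_on {0<..} critical_rate"
  unfolding critical_rate_def[abs_def] using ln_base_pos by (intro continuous_intros continuous_on_tilted_rate) auto

text \<open>The change of measure to \<open>tilted u\<close> misses \<open>exponent_at R u\<close> by
  \<open>(u - 1) * (R - critical_rate u)\<close>. This gap vanishes at \<open>u = 1\<close> as well as at
  \<open>critical_rate u = R\<close>, so no case distinction between \<open>R < I\<close> and \<open>R \<ge> I\<close> is needed.\<close>

lemma small_gap_above_1:
  assumes v: "v > 1" "critical_rate v < R" and \<epsilon>: "\<epsilon> > 0"
  shows "\<exists>u>1. critical_rate u < R \<and> (u - 1) * (R - critical_rate u) \<le> \<epsilon>"
proof (cases "(v - 1) * (R - critical_rate v) \<le> \<epsilon>")
  case False
  have "continuous_on {1..v} (\<lambda>u. (u - 1) * (R - critical_rate u))"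
    by (intro continuous_intros continuous_on_subset[OF continuous_on_critical_rate]) auto
  \<comment> \<open>The gap is 0 at \<open>u = 1\<close> and exceeds \<open>\<epsilon>\<close> at
    \<open>v\<close>. Where it equals \<open>\<epsilon> > 0\<close>, \<open>u \<ge> 1\<close> forces
    both factors to be positive.\<close>
  from IVT'[OF _ _ _ this, of \<epsilon>] obtain u where u: "1 \<le> u" "u \<le> v" "(u - 1) * (R - critical_rate u) = \<epsilon>"
    using v \<epsilon> False by auto
  with \<epsilon> have "(u - 1) * (R - critical_rate u) > 0" by simp
  with u(1) have "u > 1" "critical_rate u < R" by (auto simp: zero_less_mult_iff)
  with u show ?thesis by auto
qed (use v in auto)

lemma small_gap_below_1:
  assumes v: "0 < v" "v < 1" "R < critical_rate v" and \<epsilon>: "\<epsilon> > 0"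
  shows "\<exists>u. 0 < u \<and> u < 1 \<and> R < critical_rate u \<and> (u - 1) * (R - critical_rate u) \<le> \<epsilon>"
proof (cases "(v - 1) * (R - critical_rate v) \<le> \<epsilon>")
  case False
  have "continuous_on {v..1} (\<lambda>u. (u - 1) * (R - critical_rate u))"
    using v by (intro continuous_intros continuous_on_subset[OF continuous_on_critical_rate]) auto
  \<comment> \<open>The mirrored situation: where the gap equals \<open>\<epsilon>\<close>, both
    factors are negative.\<close>
  from IVT2'[OF _ _ _ this, of \<epsilon>] obtain u where u: "v \<le> u" "u \<le> 1" "(u - 1) * (R - critical_rate u) = \<epsilon>"
    using v \<epsilon> False by auto
  with \<epsilon> have "(u - 1) * (R - critical_rate u) > 0" by simp
  with u(2) have "u < 1" "R < critical_rate u" by (auto simp: zero_less_mult_iff)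
  with u v show ?thesis by (intro exI[of _ u]) auto
qed (use v in auto)

section \<open>Threshold rates\<close>

lemma exponent_at_1: "exponent_at R 1 = 0"
  by (simp add: exponent_at_def gallager_1)

lemma has_real_derivative_exponent_at:
  assumes "u > 0"
  shows "(exponent_at R has_real_derivative critical_rate u - R) (at u)"
  unfolding exponent_at_def[abs_def] critical_rate_def
  using has_real_derivative_ln_gallager[OF assms, of P] gallager_pos[of P u]
  by (intro DERIV_cong[OF DERIV_diff[OF _ DERIV_cdivide]]) (auto intro!: derivative_eq_intros)

lemma mutual_info_eq_critical_rate: "mutual_info b P = ereal (critical_rate 1)"
  using mutual_info_eq[OF b] by (simp add: critical_rate_def)

lemma tendsto_base_powr_0: "c > 0 \<Longrightarrow> (\<lambda>n. b powr (- real n * c)) \<longlonglongrightarrow> 0"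
proof -
  assume c: "c > 0"
  have "(\<lambda>n. (b powr - c) ^ n) \<longlonglongrightarrow> 0"
    using b c by (intro LIMSEQ_realpow_zero) (auto simp: powr_less_one)
  then show ?thesis using b by (simp add: powr_power mult_ac)
qed

text \<open>\<open>exponent_at R\<close> is 0 at 1 with positive slope
  \<open>critical_rate 1 - R\<close>, hence positive at some \<open>u > 1\<close>, where the direct
  bound decays exponentially.\<close>

lemma opt_type1_at_rate_tendsto_0:
  assumes "R < critical_rate 1"
  shows "opt_error R \<longlonglongrightarrow> 0"
proof -
  obtain d where d: "d > 0" "\<And>h. 0 < h \<Longrightarrow> h < d \<Longrightarrow> exponent_at R 1 < exponent_at R (1 + h)"
    using DERIV_pos_inc_right[OF has_real_derivative_exponent_at[of 1 R]] assms by auto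
  then have pos: "exponent_at R (1 + d / 2) > 0" by (force simp: exponent_at_1)
  show ?thesis
    using d(1) opt_type1_at_rate_range(1) opt_type1_at_rate_le[of "1 + d / 2"]
    by (intro tendsto_sandwich[OF _ _ tendsto_const tendsto_base_powr_0[OF pos]] always_eventually allI) auto
qed

text \<open>Here the slope at 1 is negative, so \<open>exponent_at R\<close> is positive at some
  \<open>u < 1\<close> and the success probability decays exponentially.\<close>

lemma opt_type1_at_rate_tendsto_1:
  assumes "R > critical_rate 1"
  shows "opt_error R \<longlonglongrightarrow> 1"
proof -
  obtain d where d: "d > 0" "\<And>h. 0 < h \<Longrightarrow> h < d \<Longrightarrow> exponent_at R 1 < exponent_at R (1 - h)"
    using DERIV_neg_dec_left[OF has_real_derivative_exponent_at[of 1 R]] assms by auto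
  \<comment> \<open>The cap 1 keeps \<open>1 - h\<close> positive, within the range of the strong
    converse bound.\<close>
  define h where "h = min d 1 / 2"
  have h: "0 < h" "h < d" "h < 1" using d(1) by (auto simp: h_def min_def)
  then have pos: "exponent_at R (1 - h) > 0" using d(2)[of h] by (simp add: exponent_at_1)
  have "(\<lambda>n. 1 - opt_error R n) \<longlonglongrightarrow> 0"
    using h opt_type1_at_rate_range(2) one_minus_opt_type1_at_rate_le[of "1 - h"]
    by (intro tendsto_sandwich[OF _ _ tendsto_const tendsto_base_powr_0[OF pos]] always_eventually allI) auto
  from tendsto_diff[OF tendsto_const[of 1] this] show ?thesis by simp
qed

text \<open>Every rate below \<open>critical_rate 1\<close> has limit 0 and every rate above it has
  limit 1. The behaviour at \<open>critical_rate 1\<close> itself stays open, so the supremum is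
  approached from below.\<close>

lemma threshold_rate_eq: "threshold_rate b P (indep_alternatives P) = mutual_info b P"
  unfolding threshold_rate_def mutual_info_eq_critical_rate
proof (rule antisym)
  show "Sup (ereal ` {R. limsup (\<lambda>n. ereal (opt_error R n)) = 0}) \<le> ereal (critical_rate 1)"
  proof (rule Sup_least, clarify)
    fix R assume R: "limsup (\<lambda>n. ereal (opt_error R n)) = 0"
    show "ereal R \<le> ereal (critical_rate 1)"
    proof (rule ccontr)
      assume "\<not> ereal R \<le> ereal (critical_rate 1)"
      then have "limsup (\<lambda>n. ereal (opt_error R n)) = ereal 1"
        using opt_type1_at_rate_tendsto_1[of R] by (intro lim_imp_Limsup) auto
      with R show False by simp
    qed
  qed
  show "ereal (critical_rate 1) \<le> Sup (ereal ` {R. limsup (\<lambda>n. ereal (opt_error R n)) = 0})"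
  proof (rule dense_le)
    fix x assume x: "x < ereal (critical_rate 1)"
    show "x \<le> Sup (ereal ` {R. limsup (\<lambda>n. ereal (opt_error R n)) = 0})"
    proof (cases x)
      case (real R)
      then have "limsup (\<lambda>n. ereal (opt_error R n)) = ereal 0"
        using opt_type1_at_rate_tendsto_0[of R] x by (intro lim_imp_Limsup) auto
      with real show ?thesis by (intro Sup_upper) (auto simp: zero_ereal_def)
    qed (use x in auto)
  qed
qed

lemma sc_threshold_rate_eq: "sc_threshold_rate b P (indep_alternatives P) = mutual_info b P"
  unfolding sc_threshold_rate_def mutual_info_eq_critical_rate
proof (rule antisym)
  show "ereal (critical_rate 1) \<le> Inf (ereal ` {R. liminf (\<lambda>n. ereal (opt_error R n)) = 1})"
  proof (rule Inf_greatest, clarify)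
    fix R assume R: "liminf (\<lambda>n. ereal (opt_error R n)) = 1"
    show "ereal (critical_rate 1) \<le> ereal R"
    proof (rule ccontr)
      assume "\<not> ereal (critical_rate 1) \<le> ereal R"
      then have "liminf (\<lambda>n. ereal (opt_error R n)) = ereal 0"
        using opt_type1_at_rate_tendsto_0[of R] by (intro lim_imp_Liminf) auto
      with R show False by simp
    qed
  qed
  show "Inf (ereal ` {R. liminf (\<lambda>n. ereal (opt_error R n)) = 1}) \<le> ereal (critical_rate 1)"
  proof (rule dense_ge)
    fix x assume x: "ereal (critical_rate 1) < x"
    show "Inf (ereal ` {R. liminf (\<lambda>n. ereal (opt_error R n)) = 1}) \<le> x"
    proof (cases x)
      case (real R)
      then have "liminf (\<lambda>n. ereal (opt_error R n)) = ereal 1"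
        using opt_type1_at_rate_tendsto_1[of R] x by (intro lim_imp_Liminf) auto
      with real show ?thesis by (intro Inf_lower) (auto simp: one_ereal_def)
    qed (use x in auto)
  qed
qed

text \<open>The expression is monotone in \<open>s\<close> because \<open>tilted_rate\<close> is
  antitone, so both limits exist in the extended reals; uniqueness identifies them with the
  \<open>Lim\<close> terms.\<close>

lemma tendsto_R_zero:
  "((\<lambda>s. ereal (s * deriv (phi b P) s - phi b P s)) \<longlongrightarrow> R_zero b P) (at_right 0)"
  and tendsto_R_infty:
  "((\<lambda>s. ereal (s * deriv (phi b P) s - phi b P s)) \<longlongrightarrow> R_infty b P) at_top"
proof -
  let ?f = "\<lambda>s. ereal (s * deriv (phi b P) s - phi b P s)"
  have mono: "?f x \<le> ?f y" if "0 < x" "x \<le> y" for x y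
    using that tilted_rate_antimono[of "1 / y" "1 / x" P] ln_base_pos
    by (simp add: phi_legendre[OF b] divide_right_mono frac_le)
  note lim = tendsto_at_right_INF[of ?f, OF mono] tendsto_at_top_SUP[of ?f, OF mono]
  show "(?f \<longlongrightarrow> R_zero b P) (at_right 0)"
    using lim(1) tendsto_Lim[OF trivial_limit_at_right_real lim(1)] by (simp add: R_zero_def)
  show "(?f \<longlongrightarrow> R_infty b P) at_top"
    using lim(2) tendsto_Lim[OF trivial_limit_at_top_linorder lim(2)] by (simp add: R_infty_def)
qed

section \<open>Error exponent and strong converse exponent\<close>

lemma error_exponent_objective:
  assumes "s > 0" "s \<noteq> 1"
  shows "ereal ((1 - s) / s) * (renyi_mutual_info b s P - ereal R) = ereal (exponent_at R (1 / s))"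
  using assms ln_base_pos unfolding renyi_mutual_info_eq[OF b assms] exponent_at_def
  by (simp add: divide_simps, (simp add: algebra_simps)?)

lemma sc_exponent_objective:
  assumes "s > 0" "s \<noteq> 1"
  shows "ereal ((s - 1) / s) * (ereal R - renyi_mutual_info b s P) = ereal (exponent_at R (1 / s))"
  using assms ln_base_pos unfolding renyi_mutual_info_eq[OF b assms] exponent_at_def
  by (simp add: divide_simps, (simp add: algebra_simps)?)

text \<open>Convergence to \<open>R_zero\<close> supplies some \<open>v > 1\<close> with
  \<open>critical_rate v < R\<close>, from which a \<open>u\<close> with small gap is obtained; the
  change of measure at \<open>u\<close> bounds even the limsup from above. The reverse inequality is
  the direct bound at every \<open>u > 1\<close>.\<close>

lemma error_exponent_eq:
  assumes R: "ereal R > R_zero b P"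
  shows "error_exponent b P (indep_alternatives P) R =
    (SUP s\<in>{0<..<1}. ereal ((1 - s) / s) * (renyi_mutual_info b s P - ereal R))"
proof (rule antisym)
  have "\<forall>\<^sub>F s in at_right 0. s \<in> {0<..<1} \<and> ereal (s * deriv (phi b P) s - phi b P s) < ereal R"
    using order_tendstoD(2)[OF tendsto_R_zero R] eventually_at_right_real[OF zero_less_one]
    by eventually_elim auto
  then obtain s where s: "s \<in> {0<..<1}" "ereal (s * deriv (phi b P) s - phi b P s) < ereal R"
    using eventually_happens'[OF trivial_limit_at_right_real] by blast
  then have v: "1 / s > 1" "critical_rate (1 / s) < R"
    by (auto simp: phi_legendre[OF b] critical_rate_def)
  show "error_exponent b P (indep_alternatives P) R \<le>
      (SUP s\<in>{0<..<1}. ereal ((1 - s) / s) * (renyi_mutual_info b s P - ereal R))"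
  proof (rule ereal_le_epsilon2)
    fix \<epsilon> :: real assume \<epsilon>: "0 < \<epsilon>"
    \<comment> \<open>Half of \<open>\<epsilon>\<close> pays for the gap, the other half for the
      slack in the change of measure.\<close>
    obtain u where u: "u > 1" "critical_rate u < R" "(u - 1) * (R - critical_rate u) \<le> \<epsilon> / 2"
      using small_gap_above_1[OF v, of "\<epsilon> / 2"] \<epsilon> by auto
    have "error_exponent b P (indep_alternatives P) R \<le> limsup (\<lambda>n. ereal (1 / real n) * neg_log b (opt_error R n))"
      unfolding error_exponent_def by (intro Liminf_le_Limsup) simp
    also have "\<dots> \<le> ereal (exponent_at R u + (u - 1) * (R - critical_rate u) + \<epsilon> / 2)"
      using u \<epsilon> by (intro limsup_neg_log_le[OF b] opt_type1_at_rate_ge) auto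
    also have "\<dots> \<le> ereal (exponent_at R (1 / (1 / u))) + ereal \<epsilon>" using u by simp
    also have "ereal (exponent_at R (1 / (1 / u))) = ereal ((1 - 1 / u) / (1 / u)) * (renyi_mutual_info b (1 / u) P - ereal R)"
      using u by (subst error_exponent_objective) auto
    also have "\<dots> \<le> (SUP s\<in>{0<..<1}. ereal ((1 - s) / s) * (renyi_mutual_info b s P - ereal R))"
      using u by (intro SUP_upper) auto
    finally show "error_exponent b P (indep_alternatives P) R \<le>
        (SUP s\<in>{0<..<1}. ereal ((1 - s) / s) * (renyi_mutual_info b s P - ereal R)) + ereal \<epsilon>"
      by (simp add: add_right_mono)
  qed
  show "(SUP s\<in>{0<..<1}. ereal ((1 - s) / s) * (renyi_mutual_info b s P - ereal R)) \<le>
      error_exponent b P (indep_alternatives P) R"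
  proof (rule SUP_least)
    fix s :: real assume s: "s \<in> {0<..<1}"
    have "ereal (exponent_at R (1 / s)) \<le> error_exponent b P (indep_alternatives P) R"
      unfolding error_exponent_def using s
      by (intro le_liminf_neg_log b opt_type1_at_rate_range opt_type1_at_rate_le) auto
    then show "ereal ((1 - s) / s) * (renyi_mutual_info b s P - ereal R) \<le> error_exponent b P (indep_alternatives P) R"
      using s by (subst error_exponent_objective) auto
  qed
qed

text \<open>The same argument on the other side of 1: convergence to \<open>R_infty\<close> supplies
  some \<open>v < 1\<close> with \<open>R < critical_rate v\<close>, and the Hoelder bound gives the
  reverse inequality already for the liminf.\<close>

lemma sc_exponent_eq:
  assumes R: "ereal R < R_infty b P"
  shows "sc_exponent b P (indep_alternatives P) R =
    (SUP s\<in>{1<..}. ereal ((s - 1) / s) * (ereal R - renyi_mutual_info b s P))"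
proof (rule antisym)
  have "\<forall>\<^sub>F s in at_top. 1 < s \<and> ereal R < ereal (s * deriv (phi b P) s - phi b P s)"
    using order_tendstoD(1)[OF tendsto_R_infty R] eventually_gt_at_top[of "1::real"]
    by eventually_elim auto
  then obtain s :: real where s: "s > 1" "ereal R < ereal (s * deriv (phi b P) s - phi b P s)"
    using eventually_happens'[OF trivial_limit_at_top_linorder] by blast
  then have v: "0 < 1 / s" "1 / s < 1" "R < critical_rate (1 / s)"
    by (auto simp: phi_legendre[OF b] critical_rate_def)
  show "sc_exponent b P (indep_alternatives P) R \<le>
      (SUP s\<in>{1<..}. ereal ((s - 1) / s) * (ereal R - renyi_mutual_info b s P))"
  proof (rule ereal_le_epsilon2)
    fix \<epsilon> :: real assume \<epsilon>: "0 < \<epsilon>"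
    obtain u where u: "0 < u" "u < 1" "R < critical_rate u" "(u - 1) * (R - critical_rate u) \<le> \<epsilon> / 2"
      using small_gap_below_1[OF v, of "\<epsilon> / 2"] \<epsilon> by auto
    have "sc_exponent b P (indep_alternatives P) R \<le> ereal (exponent_at R u + (u - 1) * (R - critical_rate u) + \<epsilon> / 2)"
      unfolding sc_exponent_def
      using u \<epsilon> by (intro limsup_neg_log_le[OF b] one_minus_opt_type1_at_rate_ge) auto
    also have "\<dots> \<le> ereal (exponent_at R (1 / (1 / u))) + ereal \<epsilon>" using u by simp
    also have "ereal (exponent_at R (1 / (1 / u))) = ereal ((1 / u - 1) / (1 / u)) * (ereal R - renyi_mutual_info b (1 / u) P)"
      using u by (subst sc_exponent_objective) auto
    also have "\<dots> \<le> (SUP s\<in>{1<..}. ereal ((s - 1) / s) * (ereal R - renyi_mutual_info b s P))"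
      using u by (intro SUP_upper) auto
    finally show "sc_exponent b P (indep_alternatives P) R \<le>
        (SUP s\<in>{1<..}. ereal ((s - 1) / s) * (ereal R - renyi_mutual_info b s P)) + ereal \<epsilon>"
      by (simp add: add_right_mono)
  qed
  show "(SUP s\<in>{1<..}. ereal ((s - 1) / s) * (ereal R - renyi_mutual_info b s P)) \<le>
      sc_exponent b P (indep_alternatives P) R"
  proof (rule SUP_least)
    fix s :: real assume s: "s \<in> {1<..}"
    have "ereal (exponent_at R (1 / s)) \<le> liminf (\<lambda>n. ereal (1 / real n) * neg_log b (1 - opt_error R n))"
      using s opt_type1_at_rate_range(2)[of R]
      by (intro le_liminf_neg_log b one_minus_opt_type1_at_rate_le) auto
    also have "\<dots> \<le> sc_exponent b P (indep_alternatives P) R"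
      unfolding sc_exponent_def by (intro Liminf_le_Limsup) simp
    finally show "ereal ((s - 1) / s) * (ereal R - renyi_mutual_info b s P) \<le> sc_exponent b P (indep_alternatives P) R"
      using s by (subst sc_exponent_objective) auto
  qed
qed

end

theorem mainTheorem5:
  fixes P :: "('x::finite \<times> 'y::finite) pmf" and b :: real
  assumes "b > 1"
  shows
    \<comment> \<open>well-posedness: the minimum, the derivative and the limits in the definitions exist\<close>
    "(\<forall>s>0. \<bar>renyi_mutual_info b s P\<bar> \<noteq> \<infinity> \<and>
        (\<exists>Q. renyi_mutual_info b s P = renyi_div b s P (pair_pmf (marg_X P) Q))) \<and>
     (\<forall>s>0. phi b P differentiable (at s)) \<and>
     ((\<lambda>s. ereal (s * deriv (phi b P) s - phi b P s)) \<longlongrightarrow> R_zero b P) (at_right 0) \<and>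
     ((\<lambda>s. ereal (s * deriv (phi b P) s - phi b P s)) \<longlongrightarrow> R_infty b P) at_top \<and>
     threshold_rate b P (indep_alternatives P) = mutual_info b P \<and>
     sc_threshold_rate b P (indep_alternatives P) = mutual_info b P \<and>
     (\<forall>R. ereal R > R_zero b P \<longrightarrow>
        error_exponent b P (indep_alternatives P) R =
          (SUP s\<in>{0<..<1}. ereal ((1 - s) / s) * (renyi_mutual_info b s P - ereal R))) \<and>
     (\<forall>R. 0 < R \<and> ereal R < R_infty b P \<longrightarrow>
        sc_exponent b P (indep_alternatives P) R =
          (SUP s\<in>{1<..}. ereal ((s - 1) / s) * (ereal R - renyi_mutual_info b s P)))"
proof (intro conjI allI impI; (elim conjE)?)
  fix s :: real assume "s > 0"
  then show "phi b P differentiable (at s)"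
    using has_real_derivative_phi[OF assms] real_differentiable_def by blast
next
  fix s :: real assume "s > 0"
  from renyi_mutual_info_attained[OF assms this, of P]
  show "\<bar>renyi_mutual_info b s P\<bar> \<noteq> \<infinity>" ..
next
  fix s :: real assume "s > 0"
  from renyi_mutual_info_attained[OF assms this, of P]
  show "\<exists>Q. renyi_mutual_info b s P = renyi_div b s P (pair_pmf (marg_X P) Q)" ..
qed (use tendsto_R_zero[OF assms] tendsto_R_infty[OF assms] threshold_rate_eq[OF assms]
    sc_threshold_rate_eq[OF assms] error_exponent_eq[OF assms] sc_exponent_eq[OF assms] in auto)

end
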